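(* Let $V$ be a finite-dimensional vector space over $\mathbb{K}=\mathbb{R}$ or $\mathbb{C}$ and let $\mathbb{V}=V\oplus V^*=E\oplus F$ be a Lagrangian splitting, with associated bivector $\pi\in\wedge^2V$. Then the graph of $\pi$ is \[\mathrm{Gr}_\pi=E^\top\wedge F .\] In particular, $\mathrm{ran}(\pi^\sharp)=\mathrm{ran}(E)\cap\mathrm{ran}(F)$, and the symplectic 2-form on $\mathrm{ran}(\pi^\sharp)$ is the difference $\omega_F-\omega_E$ of the restrictions to $\mathrm{ran}(\pi^\sharp)$ of the 2-forms $\omega_F$ on $\mathrm{ran}(F)$ and $\omega_E$ on $\mathrm{ran}(E)$. Moreover, if $\phi,\psi\in\wedge V^*$ are pure spinors defining $E,F$ respectively, then \[\phi^\top\wedge\psi=e^{-\iota(\pi)}\big((\phi^\top\wedge\psi)^{[\mathrm{top}]}\big).\]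
   Context: $\mathbb{V}=V\oplus V^*$ carries the symmetric bilinear form $\langle v_1\oplus\alpha_1,v_2\oplus\alpha_2\rangle=\alpha_1(v_2)+\alpha_2(v_1)$. A subspace $E$ is Lagrangian if $E=E^\perp$; a Lagrangian splitting is a direct sum decomposition $\mathbb{V}=E\oplus F$ into Lagrangian subspaces. The Clifford algebra of $\mathbb{V}$ (relations $ww'+w'w=\langle w,w'\rangle$) acts on $\wedge V^*$ by $\varrho(v\oplus\alpha)=\alpha\wedge\cdot+\iota(v)$. A nonzero $\phi\in\wedge V^*$ is a pure spinor defining the Lagrangian subspace $E$ if $\{w\in\mathbb{V}:\varrho(w)\phi=0\}=E$. $\top$ is the anti-automorphism of $\wedge V^*$ equal to the identity on $V^*$; $[\mathrm{top}]$ denotes the top degree part. $\iota:\wedge V\to\mathrm{End}(\wedge V^* )$ is the extension of $v\mapsto\iota(v)$ as an algebra homomorphism. For a Lagrangian subspace $E$: $\mathrm{ran}(E)=\mathrm{pr}_V(E)\subset V$, and it carries the 2-form $\omega_E(v,v')=\langle\alpha,v'\rangle$ for any lifts $v\oplus\alpha,\ v'\oplus\alpha'\in E$ of $v,v'\in \mathrm{ran}(E)$ (well defined). Define \[E^\top\wedge F=\{v\oplus\alpha\,:\ \exists\, v\oplus\alpha_1\in E,\ v\oplus\alpha_2\in F\text{ with }\alpha=\alpha_2-\alpha_1\}.\] Let $\mathsf p:\mathbb{V}\to\mathbb{V}$ be the projection onto $E$ along $F$. The bivector $\pi\in\wedge^2V$ of the splitting is defined by $\pi^\sharp(\alpha):=\pi(\alpha,\cdot)=-\mathrm{pr}_V(\mathsf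 p(\alpha))$ for $\alpha\in V^*$. Its graph is $\mathrm{Gr}_\pi=\{\pi^\sharp(\alpha)\oplus\alpha:\alpha\in V^*\}$, a Lagrangian subspace. The symplectic 2-form on $\mathrm{ran}(\pi^\sharp)=\mathrm{ran}(\mathrm{Gr}_\pi)$ is the 2-form $\omega_{\mathrm{Gr}_\pi}$ given by $\omega_{\mathrm{Gr}_\pi}(v,v')=\langle\alpha,v'\rangle$ for any lifts $v\oplus\alpha,\ v'\oplus\alpha'\in\mathrm{Gr}_\pi$ of $v,v'\in\mathrm{ran}(\mathrm{Gr}_\pi)$, i.e. $(\pi^\sharp\alpha,v')\mapsto\langle\alpha,v'\rangle$. *)

theory Defs
  imports Complex_Main "HOL-Library.Function_Algebras" "HOL-Library.Product_Plus"
begin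

text \<open>
  Throughout, \<open>V\<close> is a whole type \<open>'v\<close> with a scalar multiplication \<open>scale\<close> (and is
  finite-dimensional when \<open>finite_dimensional_vector_space scale Basis\<close> holds). The scalars
  \<open>'k\<close> are of class \<open>real_normed_field\<close>, whose members are \<open>\<real>\<close> and \<open>\<complex>\<close> up to
  isomorphism (Gelfand-Mazur). Sums and differences of functions and of pairs are pointwise.
\<close>

section \<open>The dual space and exterior algebras\<close>

definition fscale :: "'k::times \<Rightarrow> ('x \<Rightarrow> 'k) \<Rightarrow> 'x \<Rightarrow> 'k" where
  "fscale c f = (\<lambda>x. c * f x)"

definition dual_space :: "('k::field \<Rightarrow> 'v::ab_group_add \<Rightarrow> 'v) \<Rightarrow> ('v \<Rightarrow> 'k) set" where
  "dual_space scale = {\<alpha>. Vector_Spaces.linear scale (*) \<alpha>}"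

text \<open>
  The exterior algebra of the dual of a finite-dimensional space \<open>W\<close>, realised as alternating
  multilinear forms. An element assigns a scalar to every list of vectors; its restriction to
  lists of length \<open>k\<close> is its component of degree \<open>k\<close>. Components of degree above \<open>dim W\<close> vanish
  automatically. Since \<open>W\<close> is a subset of a type, forms are \<open>0\<close> off \<open>lists W\<close>.
\<close>

definition alt_forms ::
    "'w::ab_group_add set \<Rightarrow> ('k::field \<Rightarrow> 'w \<Rightarrow> 'w) \<Rightarrow> ('w list \<Rightarrow> 'k) set" where
  "alt_forms W s = {\<phi>.
     (\<forall>xs\<in>lists W. \<forall>ys\<in>lists W. \<forall>u\<in>W. \<forall>v\<in>W. \<forall>c.
        \<phi> (xs @ (u + v) # ys) = \<phi> (xs @ u # ys) + \<phi> (xs @ v # ys) \<and>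
        \<phi> (xs @ s c u # ys) = c * \<phi> (xs @ u # ys)) \<and>
     (\<forall>xs\<in>lists W. \<not> distinct xs \<longrightarrow> \<phi> xs = 0) \<and>
     (\<forall>xs. xs \<notin> lists W \<longrightarrow> \<phi> xs = 0)}"

text \<open>\<open>\<wedge>V\<^sup>*\<close> is the algebra of alternating forms on \<open>V\<close>, and \<open>\<wedge>V\<close>, via \<open>V = V\<^sup>*\<^sup>*\<close>, that
  of alternating forms on \<open>V\<^sup>*\<close>.\<close>

abbreviation forms :: "('k::field \<Rightarrow> 'v::ab_group_add \<Rightarrow> 'v) \<Rightarrow> ('v list \<Rightarrow> 'k) set" where
  "forms scale \<equiv> alt_forms UNIV scale"

abbreviation multivectors ::
    "('k::field \<Rightarrow> 'v::ab_group_add \<Rightarrow> 'v) \<Rightarrow> (('v \<Rightarrow> 'k) list \<Rightarrow> 'k) set" where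
  "multivectors scale \<equiv> alt_forms (dual_space scale) fscale"

definition ext_one :: "'w list \<Rightarrow> 'k::zero_neq_one" where
  "ext_one xs = (if xs = [] then 1 else 0)"

definition degree_one :: "'w set \<Rightarrow> ('w \<Rightarrow> 'k) \<Rightarrow> 'w list \<Rightarrow> 'k::zero" where
  "degree_one W f xs = (case xs of [x] \<Rightarrow> if x \<in> W then f x else 0 | _ \<Rightarrow> 0)"

abbreviation covector :: "('v \<Rightarrow> 'k) \<Rightarrow> 'v list \<Rightarrow> 'k::zero" where
  "covector \<alpha> \<equiv> degree_one UNIV \<alpha>"

abbreviation bidual_vec ::
    "('k::field \<Rightarrow> 'v::ab_group_add \<Rightarrow> 'v) \<Rightarrow> 'v \<Rightarrow> ('v \<Rightarrow> 'k) list \<Rightarrow> 'k" where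
  "bidual_vec scale v \<equiv> degree_one (dual_space scale) (\<lambda>\<alpha>. \<alpha> v)"

text \<open>Exterior product by the shuffle formula; \<open>I\<close> is the set of positions given to \<open>\<phi>\<close>,
  so that \<open>(\<alpha> \<and> \<beta>)(u, v) = \<alpha>(u) \<beta>(v) - \<alpha>(v) \<beta>(u)\<close>.\<close>

definition shuffle_sign :: "nat \<Rightarrow> nat set \<Rightarrow> 'k::comm_ring_1" where
  "shuffle_sign n I = (- 1) ^ card {(i, j). i \<in> I \<and> j \<in> {..<n} - I \<and> j < i}"

definition wedge ::
    "('w list \<Rightarrow> 'k::comm_ring_1) \<Rightarrow> ('w list \<Rightarrow> 'k) \<Rightarrow> 'w list \<Rightarrow> 'k" where
  "wedge \<phi> \<psi> xs =
     (\<Sum>I\<in>Pow {..<length xs}. shuffle_sign (length xs) I * \<phi> (nths xs I) * \<psi> (nths xs (- I)))"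

definition int_prod :: "'w \<Rightarrow> ('w list \<Rightarrow> 'k) \<Rightarrow> 'w list \<Rightarrow> 'k" where
  "int_prod v \<phi> xs = \<phi> (v # xs)"

definition linear_endo ::
    "('k::field \<Rightarrow> 'v::ab_group_add \<Rightarrow> 'v) \<Rightarrow> (('v list \<Rightarrow> 'k) \<Rightarrow> 'v list \<Rightarrow> 'k) \<Rightarrow> bool" where
  "linear_endo scale A \<longleftrightarrow>
     (\<forall>\<phi>\<in>forms scale. A \<phi> \<in> forms scale) \<and>
     (\<forall>\<phi>\<in>forms scale. \<forall>\<psi>\<in>forms scale. A (\<phi> + \<psi>) = A \<phi> + A \<psi>) \<and>
     (\<forall>c. \<forall>\<phi>\<in>forms scale. A (fscale c \<phi>) = fscale c (A \<phi>))"

text \<open>The anti-automorphism \<open>\<top>\<close> of \<open>\<wedge>V\<^sup>*\<close> and the algebra homomorphism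
  \<open>\<iota> : \<wedge>V \<rightarrow> End(\<wedge>V\<^sup>*)\<close> extending \<open>v \<mapsto> \<iota>(v)\<close> are defined by description. Existence and
  uniqueness (on \<open>\<wedge>V\<^sup>*\<close>) of the former and existence of the latter are proved below.\<close>

definition is_transpose ::
    "('k::field \<Rightarrow> 'v::ab_group_add \<Rightarrow> 'v) \<Rightarrow> (('v list \<Rightarrow> 'k) \<Rightarrow> 'v list \<Rightarrow> 'k) \<Rightarrow> bool" where
  "is_transpose scale T \<longleftrightarrow>
     linear_endo scale T \<and> bij_betw T (forms scale) (forms scale) \<and>
     T ext_one = ext_one \<and>
     (\<forall>\<phi>\<in>forms scale. \<forall>\<psi>\<in>forms scale. T (wedge \<phi> \<psi>) = wedge (T \<psi>) (T \<phi>)) \<and>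
     (\<forall>\<alpha>\<in>dual_space scale. T (covector \<alpha>) = covector \<alpha>)"

definition form_transpose ::
    "('k::field \<Rightarrow> 'v::ab_group_add \<Rightarrow> 'v) \<Rightarrow> ('v list \<Rightarrow> 'k) \<Rightarrow> 'v list \<Rightarrow> 'k" where
  "form_transpose scale = (SOME T. is_transpose scale T)"

definition is_contraction ::
    "('k::field \<Rightarrow> 'v::ab_group_add \<Rightarrow> 'v) \<Rightarrow>
     ((('v \<Rightarrow> 'k) list \<Rightarrow> 'k) \<Rightarrow> ('v list \<Rightarrow> 'k) \<Rightarrow> 'v list \<Rightarrow> 'k) \<Rightarrow> bool" where
  "is_contraction scale \<iota> \<longleftrightarrow>
     (\<forall>\<xi>\<in>multivectors scale. linear_endo scale (\<iota> \<xi>)) \<and>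
     (\<forall>\<phi>\<in>forms scale.
        \<iota> ext_one \<phi> = \<phi> \<and>
        (\<forall>\<xi>\<in>multivectors scale. \<forall>\<eta>\<in>multivectors scale.
           \<iota> (\<xi> + \<eta>) \<phi> = \<iota> \<xi> \<phi> + \<iota> \<eta> \<phi> \<and> \<iota> (wedge \<xi> \<eta>) \<phi> = \<iota> \<xi> (\<iota> \<eta> \<phi>)) \<and>
        (\<forall>c. \<forall>\<xi>\<in>multivectors scale. \<iota> (fscale c \<xi>) \<phi> = fscale c (\<iota> \<xi> \<phi>)) \<and>
        (\<forall>v. \<iota> (bidual_vec scale v) \<phi> = int_prod v \<phi>))"

definition contraction ::
    "('k::field \<Rightarrow> 'v::ab_group_add \<Rightarrow> 'v) \<Rightarrow>
     (('v \<Rightarrow> 'k) list \<Rightarrow> 'k) \<Rightarrow> ('v list \<Rightarrow> 'k) \<Rightarrow> 'v list \<Rightarrow> 'k" where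
  "contraction scale = (SOME \<iota>. is_contraction scale \<iota>)"

definition top_part ::
    "('k::field \<Rightarrow> 'v::ab_group_add \<Rightarrow> 'v) \<Rightarrow> ('v list \<Rightarrow> 'k) \<Rightarrow> 'v list \<Rightarrow> 'k" where
  "top_part scale \<phi> xs = (if length xs = vector_space.dim scale UNIV then \<phi> xs else 0)"

text \<open>The exponential series of an operator on \<open>\<wedge>V\<^sup>*\<close>, evaluated coefficientwise. It is
  a finite sum for the nilpotent operators to which it is applied.\<close>

definition op_exp ::
    "(('v list \<Rightarrow> 'k) \<Rightarrow> 'v list \<Rightarrow> 'k) \<Rightarrow> ('v list \<Rightarrow> 'k) \<Rightarrow> 'v list \<Rightarrow> 'k::real_normed_field" where
  "op_exp A \<phi> xs = (\<Sum>n. (A ^^ n) \<phi> xs / fact n)"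

section \<open>Lagrangian splittings of \<open>V \<oplus> V\<^sup>*\<close>\<close>

definition double_space :: "('k::field \<Rightarrow> 'v::ab_group_add \<Rightarrow> 'v) \<Rightarrow> ('v \<times> ('v \<Rightarrow> 'k)) set" where
  "double_space scale = UNIV \<times> dual_space scale"

definition double_scale ::
    "('k::field \<Rightarrow> 'v::ab_group_add \<Rightarrow> 'v) \<Rightarrow> 'k \<Rightarrow> 'v \<times> ('v \<Rightarrow> 'k) \<Rightarrow> 'v \<times> ('v \<Rightarrow> 'k)" where
  "double_scale scale c w = (scale c (fst w), fscale c (snd w))"

definition pairing :: "'v \<times> ('v \<Rightarrow> 'k) \<Rightarrow> 'v \<times> ('v \<Rightarrow> 'k) \<Rightarrow> 'k::plus" where
  "pairing w w' = snd w (fst w') + snd w' (fst w)"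

definition perp ::
    "('k::field \<Rightarrow> 'v::ab_group_add \<Rightarrow> 'v) \<Rightarrow> ('v \<times> ('v \<Rightarrow> 'k)) set \<Rightarrow> ('v \<times> ('v \<Rightarrow> 'k)) set" where
  "perp scale E = {w \<in> double_space scale. \<forall>w'\<in>E. pairing w w' = 0}"

definition lagrangian ::
    "('k::field \<Rightarrow> 'v::ab_group_add \<Rightarrow> 'v) \<Rightarrow> ('v \<times> ('v \<Rightarrow> 'k)) set \<Rightarrow> bool" where
  "lagrangian scale E \<longleftrightarrow>
     E \<subseteq> double_space scale \<and> module.subspace (double_scale scale) E \<and> E = perp scale E"

definition lagrangian_splitting ::
    "('k::field \<Rightarrow> 'v::ab_group_add \<Rightarrow> 'v) \<Rightarrow>
     ('v \<times> ('v \<Rightarrow> 'k)) set \<Rightarrow> ('v \<times> ('v \<Rightarrow> 'k)) set \<Rightarrow> bool" where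
  "lagrangian_splitting scale E F \<longleftrightarrow>
     lagrangian scale E \<and> lagrangian scale F \<and>
     E \<inter> F = {0} \<and> {e + f | e f. e \<in> E \<and> f \<in> F} = double_space scale"

definition proj_along :: "'a::ab_group_add set \<Rightarrow> 'a set \<Rightarrow> 'a \<Rightarrow> 'a" where
  "proj_along E F w = (THE e. e \<in> E \<and> (\<exists>f\<in>F. w = e + f))"

definition clifford_action ::
    "'v \<times> ('v \<Rightarrow> 'k) \<Rightarrow> ('v list \<Rightarrow> 'k) \<Rightarrow> 'v list \<Rightarrow> 'k::comm_ring_1" where
  "clifford_action w \<phi> = wedge (covector (snd w)) \<phi> + int_prod (fst w) \<phi>"

definition pure_spinor_defining ::
    "('k::field \<Rightarrow> 'v::ab_group_add \<Rightarrow> 'v) \<Rightarrow>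
     ('v list \<Rightarrow> 'k) \<Rightarrow> ('v \<times> ('v \<Rightarrow> 'k)) set \<Rightarrow> bool" where
  "pure_spinor_defining scale \<phi> E \<longleftrightarrow>
     \<phi> \<in> forms scale \<and> \<phi> \<noteq> 0 \<and> lagrangian scale E \<and>
     {w \<in> double_space scale. clifford_action w \<phi> = 0} = E"

definition range_V :: "('v \<times> ('v \<Rightarrow> 'k)) set \<Rightarrow> 'v set" where
  "range_V E = fst ` E"

definition two_form :: "('v \<times> ('v \<Rightarrow> 'k)) set \<Rightarrow> 'v \<Rightarrow> 'v \<Rightarrow> 'k" where
  "two_form E v v' = (THE c. \<exists>\<alpha> \<alpha>'. (v, \<alpha>) \<in> E \<and> (v', \<alpha>') \<in> E \<and> c = \<alpha> v')"

definition top_wedge ::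
    "('v \<times> ('v \<Rightarrow> 'k)) set \<Rightarrow> ('v \<times> ('v \<Rightarrow> 'k)) set \<Rightarrow> ('v \<times> ('v \<Rightarrow> 'k::ab_group_add)) set" where
  "top_wedge E F = {(v, \<alpha>). \<exists>\<alpha>\<^sub>1 \<alpha>\<^sub>2. (v, \<alpha>\<^sub>1) \<in> E \<and> (v, \<alpha>\<^sub>2) \<in> F \<and> \<alpha> = \<alpha>\<^sub>2 - \<alpha>\<^sub>1}"

text \<open>The vector \<open>\<pi>\<^sup>\<sharp>(\<alpha>) = \<pi>(\<alpha>, \<cdot>)\<close>, an element of \<open>V\<^sup>*\<^sup>*\<close> read in \<open>V\<close>.\<close>

definition sharp ::
    "('k::field \<Rightarrow> 'v::ab_group_add \<Rightarrow> 'v) \<Rightarrow> (('v \<Rightarrow> 'k) list \<Rightarrow> 'k) \<Rightarrow> ('v \<Rightarrow> 'k) \<Rightarrow> 'v" where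
  "sharp scale \<pi> \<alpha> = (THE v. \<forall>\<beta>\<in>dual_space scale. \<beta> v = \<pi> [\<alpha>, \<beta>])"

definition bivector_graph ::
    "('k::field \<Rightarrow> 'v::ab_group_add \<Rightarrow> 'v) \<Rightarrow> (('v \<Rightarrow> 'k) list \<Rightarrow> 'k) \<Rightarrow> ('v \<times> ('v \<Rightarrow> 'k)) set" where
  "bivector_graph scale \<pi> = (\<lambda>\<alpha>. (sharp scale \<pi> \<alpha>, \<alpha>)) ` dual_space scale"

text \<open>The bivector of a splitting, \<open>\<pi>(\<alpha>, \<beta>) = \<langle>\<beta>, - pr\<^sub>V (p \<alpha>)\<rangle>\<close>; that it lies in
  \<open>\<wedge>\<^sup>2V\<close> and that \<open>\<pi>\<^sup>\<sharp>(\<alpha>) = - pr\<^sub>V (p \<alpha>)\<close> is proved at the end.\<close>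

definition splitting_bivector ::
    "('k::field \<Rightarrow> 'v::ab_group_add \<Rightarrow> 'v) \<Rightarrow>
     ('v \<times> ('v \<Rightarrow> 'k)) set \<Rightarrow> ('v \<times> ('v \<Rightarrow> 'k)) set \<Rightarrow> ('v \<Rightarrow> 'k) list \<Rightarrow> 'k" where
  "splitting_bivector scale E F xs =
     (case xs of
        [\<alpha>, \<beta>] \<Rightarrow> if \<alpha> \<in> dual_space scale \<and> \<beta> \<in> dual_space scale
                  then \<beta> (- fst (proj_along E F (0, \<alpha>))) else 0
      | _ \<Rightarrow> 0)"

section \<open>Existence and uniqueness of the objects defined by description\<close>

subsection \<open>The exterior product\<close>

definition grade :: "('w list \<Rightarrow> 'k) \<Rightarrow> 'w list \<Rightarrow> 'k::comm_ring_1" where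
  "grade \<phi> xs = (- 1) ^ length xs * \<phi> xs"

lemma wedge_Nil [simp]: "wedge \<phi> \<psi> [] = \<phi> [] * \<psi> []"
  by (simp add: wedge_def shuffle_sign_def)

lemma shuffle_sign_insert0:
  assumes "J \<subseteq> {..<n}"
  shows "shuffle_sign (Suc n) (insert 0 (Suc ` J)) = shuffle_sign n J"
proof -
  have "{(i, j). i \<in> insert 0 (Suc ` J) \<and> j \<in> {..<Suc n} - insert 0 (Suc ` J) \<and> j < i}
      = (\<lambda>(i, j). (Suc i, Suc j)) ` {(i, j). i \<in> J \<and> j \<in> {..<n} - J \<and> j < i}" (is "?A = ?f ` ?B")
  proof (intro set_eqI iffI)
    fix p assume "p \<in> ?A"
    then obtain i j where p: "p = (i, j)" "i \<in> insert 0 (Suc ` J)" "j < Suc n"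
      "j \<notin> insert 0 (Suc ` J)" "j < i" by auto
    then obtain i' j' where "i = Suc i'" "i' \<in> J" "j = Suc j'"
      by (metis image_iff insertE insert_iff less_zeroE not0_implies_Suc)
    with p show "p \<in> ?f ` ?B" by (auto intro!: image_eqI[of _ _ "(i', j')"])
  qed auto
  moreover have "inj_on ?f ?B" by (auto simp: inj_on_def)
  ultimately show ?thesis unfolding shuffle_sign_def by (simp only: card_image)
qed

lemma shuffle_sign_Suc:
  assumes "J \<subseteq> {..<n}"
  shows "shuffle_sign (Suc n) (Suc ` J) = (- 1) ^ card J * (shuffle_sign n J :: 'k::comm_ring_1)"
proof -
  let ?f = "\<lambda>(i::nat, j::nat). (Suc i, Suc j)"
  let ?B = "{(i, j). i \<in> J \<and> j \<in> {..<n} - J \<and> j < i}"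
  let ?C = "(\<lambda>i. (Suc i, 0::nat)) ` J"
  have fin: "finite J" using assms finite_subset by blast
  have finB: "finite ?B" by (rule finite_subset[of _ "J \<times> {..<n}"]) (use fin in auto)
  have "{(i, j). i \<in> Suc ` J \<and> j \<in> {..<Suc n} - Suc ` J \<and> j < i} = ?f ` ?B \<union> ?C" (is "?A = _")
  proof (intro set_eqI iffI)
    fix p assume "p \<in> ?A"
    then obtain i j where p: "p = (Suc i, j)" "i \<in> J" "j < Suc n" "j \<notin> Suc ` J" "j < Suc i" by auto
    show "p \<in> ?f ` ?B \<union> ?C"
    proof (cases j)
      case (Suc j') with p show ?thesis by (auto intro!: image_eqI[of _ _ "(i, j')"])
    qed (use p in auto)
  qed auto
  moreover have "inj_on ?f ?B" by (auto simp: inj_on_def)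
  moreover have "inj_on (\<lambda>i. (Suc i, 0::nat)) J" by (auto simp: inj_on_def)
  moreover have "?f ` ?B \<inter> ?C = {}" by auto
  ultimately have "card {(i, j). i \<in> Suc ` J \<and> j \<in> {..<Suc n} - Suc ` J \<and> j < i} = card ?B + card J"
    using fin finB by (simp only: card_Un_disjoint finite_imageI card_image)
  then show ?thesis unfolding shuffle_sign_def by (simp add: power_add mult.commute)
qed

lemma Pow_lessThan_Suc:
  "Pow {..<Suc n} = (\<lambda>J. insert 0 (Suc ` J)) ` Pow {..<n} \<union> (\<lambda>J. Suc ` J) ` Pow {..<n}"
  unfolding lessThan_Suc_eq_insert_0 Pow_insert image_Pow_surj[OF refl, symmetric] image_image
  by (rule Un_commute)

lemma length_nths_subset:
  assumes "I \<subseteq> {..<length xs}" shows "length (nths xs I) = card I"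
proof -
  have "{i. i < length xs \<and> i \<in> I} = I" using assms by auto
  then show ?thesis by (simp add: length_nths)
qed

lemma wedge_Cons:
  "wedge \<phi> \<psi> (x # xs) = wedge (int_prod x \<phi>) \<psi> xs + wedge (grade \<phi>) (int_prod x \<psi>) xs"
proof -
  let ?n = "length xs"
  let ?i = "\<lambda>J. insert 0 (Suc ` J)"
  let ?s = "\<lambda>J. Suc ` J"
  let ?t = "\<lambda>I. shuffle_sign (Suc ?n) I * \<phi> (nths (x # xs) I) * \<psi> (nths (x # xs) (- I))"
  have s1: "{j. Suc j \<in> ?i J} = J" "{j. Suc j \<in> - ?i J} = - J"
    "{j. Suc j \<in> ?s J} = J" "{j. Suc j \<in> - ?s J} = - J" for J by auto
  have n1: "nths (x # xs) (?i J) = x # nths xs J" "nths (x # xs) (- ?i J) = nths xs (- J)"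
    "nths (x # xs) (?s J) = nths xs J" "nths (x # xs) (- ?s J) = x # nths xs (- J)" for J
    by (simp_all only: nths_Cons s1) auto
  have inj: "inj_on ?i (Pow {..<?n})" "inj_on ?s (Pow {..<?n})"
    by (rule inj_on_inverseI[of _ "\<lambda>I. {j. Suc j \<in> I}"], rule s1)+
  have "wedge \<phi> \<psi> (x # xs) = sum ?t (Pow {..<Suc ?n})" by (simp only: wedge_def list.size) simp
  also have "\<dots> = sum ?t (?i ` Pow {..<?n}) + sum ?t (?s ` Pow {..<?n})"
    unfolding Pow_lessThan_Suc by (rule sum.union_disjoint) auto
  also have "sum ?t (?i ` Pow {..<?n}) = wedge (int_prod x \<phi>) \<psi> xs"
    unfolding sum.reindex[OF inj(1)] wedge_def o_def n1
    by (intro sum.cong refl) (simp add: shuffle_sign_insert0 int_prod_def)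
  also have "sum ?t (?s ` Pow {..<?n}) = wedge (grade \<phi>) (int_prod x \<psi>) xs"
    unfolding sum.reindex[OF inj(2)] wedge_def o_def n1
    by (intro sum.cong refl)
      (simp add: shuffle_sign_Suc int_prod_def grade_def length_nths_subset mult_ac)
  finally show ?thesis .
qed

lemma fscale_add: "fscale c (f + g) = fscale c f + fscale c g" for c :: "'k::semiring"
  by (simp add: fscale_def fun_eq_iff distrib_left)

lemma wedge_add_left: "wedge (\<phi> + \<phi>') \<psi> = wedge \<phi> \<psi> + wedge \<phi>' \<psi>"
  and wedge_add_right: "wedge \<psi> (\<phi> + \<phi>') = wedge \<psi> \<phi> + wedge \<psi> \<phi>'"
  by (simp_all add: wedge_def fun_eq_iff distrib_left distrib_right sum.distrib)

lemma wedge_scale_left: "wedge (fscale c \<phi>) \<psi> = fscale c (wedge \<phi> \<psi>)"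
  and wedge_scale_right: "wedge \<psi> (fscale c \<phi>) = fscale c (wedge \<psi> \<phi>)"
  by (simp_all add: wedge_def fun_eq_iff fscale_def sum_distrib_left mult_ac)

lemma wedge_zero_left [simp]: "wedge 0 \<psi> = 0" and wedge_zero_right [simp]: "wedge \<psi> 0 = 0"
  by (auto simp: wedge_def fun_eq_iff)

lemma int_prod_add: "int_prod v (\<phi> + \<psi>) = int_prod v \<phi> + int_prod v \<psi>"
  and int_prod_scale: "int_prod v (fscale c \<phi>) = fscale c (int_prod v \<phi>)"
  and int_prod_zero [simp]: "int_prod v (0 :: 'w list \<Rightarrow> 'k::comm_ring_1) = 0"
  for \<phi> \<psi> :: "'w list \<Rightarrow> 'k::comm_ring_1"
  by (auto simp: int_prod_def fun_eq_iff fscale_def)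

lemma grade_add: "grade (\<phi> + \<psi>) = grade \<phi> + grade \<psi>"
  and grade_scale: "grade (fscale c \<phi>) = fscale c (grade \<phi>)"
  and grade_int_prod: "int_prod v (grade \<phi>) = fscale (- 1) (grade (int_prod v \<phi>))"
  and grade_grade [simp]: "grade (grade \<phi>) = \<phi>"
  and grade_one [simp]: "grade ext_one = ext_one"
  by (simp_all add: grade_def fun_eq_iff fscale_def distrib_left distrib_right mult_ac int_prod_def ext_one_def)

lemma int_prod_one [simp]: "int_prod v ext_one = 0"
  by (auto simp: int_prod_def fun_eq_iff ext_one_def)

lemma int_prod_covector: "int_prod v (covector \<alpha>) = fscale (\<alpha> v) ext_one"
  for \<alpha> :: "'v \<Rightarrow> 'k::comm_ring_1"
  by (auto simp: int_prod_def fun_eq_iff ext_one_def degree_one_def fscale_def split: list.splits)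

lemma grade_covector: "grade (covector \<alpha>) = fscale (- 1) (covector \<alpha>)"
  by (auto simp: grade_def fun_eq_iff degree_one_def fscale_def split: list.splits)

lemma wedge_one_left [simp]: "wedge ext_one \<phi> = \<phi>"
proof
  show "wedge ext_one \<phi> xs = \<phi> xs" for xs
    by (induction xs arbitrary: \<phi>) (simp_all add: wedge_Cons, simp_all add: ext_one_def int_prod_def)
qed

lemma int_prod_wedge:
  "int_prod v (wedge \<phi> \<psi>) = wedge (int_prod v \<phi>) \<psi> + wedge (grade \<phi>) (int_prod v \<psi>)"
  by (simp add: fun_eq_iff int_prod_def[of v "wedge \<phi> \<psi>"] wedge_Cons)

lemma int_prod_covector_wedge:
  "int_prod v (wedge (covector \<alpha>) \<phi>) = fscale (\<alpha> v) \<phi> + fscale (- 1) (wedge (covector \<alpha>) (int_prod v \<phi>))"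
  by (simp add: int_prod_wedge int_prod_covector grade_covector wedge_scale_left)

subsection \<open>Reversal\<close>

definition rev_form :: "('w list \<Rightarrow> 'k) \<Rightarrow> 'w list \<Rightarrow> 'k" where
  "rev_form \<phi> xs = \<phi> (rev xs)"

definition rinterior :: "'w \<Rightarrow> ('w list \<Rightarrow> 'k) \<Rightarrow> 'w list \<Rightarrow> 'k" where
  "rinterior v \<phi> xs = \<phi> (xs @ [v])"

lemma wedge_snoc:
  fixes \<phi> \<psi> :: "'w list \<Rightarrow> 'k::comm_ring_1"
  shows "wedge \<phi> \<psi> (xs @ [v]) = wedge \<phi> (rinterior v \<psi>) xs + wedge (rinterior v \<phi>) (grade \<psi>) xs"
proof (induction xs arbitrary: \<phi> \<psi>)
  case Nil
  show ?case by (simp add: wedge_Cons) (simp add: rinterior_def int_prod_def grade_def)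
next
  case (Cons x xs)
  have "int_prod x (rinterior v f) = rinterior v (int_prod x f)" for f :: "'w list \<Rightarrow> 'k"
    by (simp add: fun_eq_iff int_prod_def rinterior_def)
  moreover have "rinterior v (grade f) = fscale (- 1) (grade (rinterior v f))" for f :: "'w list \<Rightarrow> 'k"
    by (simp add: fun_eq_iff grade_def rinterior_def fscale_def)
  ultimately show ?case
    by (simp add: wedge_Cons Cons.IH grade_int_prod wedge_scale_left wedge_scale_right algebra_simps)
qed

lemma rev_form_wedge:
  fixes \<phi> \<psi> :: "'w list \<Rightarrow> 'k::comm_ring_1"
  shows "rev_form (wedge \<phi> \<psi>) = wedge (rev_form \<psi>) (rev_form \<phi>)"
proof
  have 1: "int_prod v (rev_form f) = rev_form (rinterior v f)" for v and f :: "'w list \<Rightarrow> 'k"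
    by (simp add: fun_eq_iff int_prod_def rinterior_def rev_form_def)
  have 2: "grade (rev_form f) = rev_form (grade f)" for f :: "'w list \<Rightarrow> 'k"
    by (simp add: fun_eq_iff grade_def rev_form_def)
  show "rev_form (wedge \<phi> \<psi>) xs = wedge (rev_form \<psi>) (rev_form \<phi>) xs" for xs
  proof (induction xs arbitrary: \<phi> \<psi>)
    case Nil show ?case by (simp add: rev_form_def mult.commute)
  next
    case (Cons x xs)
    have "rev_form (wedge \<phi> \<psi>) (x # xs)
        = rev_form (wedge \<phi> (rinterior x \<psi>)) xs + rev_form (wedge (rinterior x \<phi>) (grade \<psi>)) xs"
      by (simp add: rev_form_def wedge_snoc)
    then show ?case by (simp add: Cons.IH wedge_Cons 1 2)
  qed
qed

subsection \<open>Alternating forms\<close>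

context finite_dimensional_vector_space
begin

lemma dualI: "(\<And>u v. \<alpha> (u + v) = \<alpha> u + \<alpha> v) \<Longrightarrow> (\<And>c u. \<alpha> (scale c u) = c * \<alpha> u) \<Longrightarrow> \<alpha> \<in> dual_space scale"
  unfolding dual_space_def by (auto intro!: Vector_Spaces.linear.intro vector_space_axioms
      simp: module_hom_def module_hom_axioms_def module_axioms Vector_Spaces.linear_def
        vector_space_def module_def algebra_simps)

lemma dual_add: "\<alpha> \<in> dual_space scale \<Longrightarrow> \<alpha> (u + v) = \<alpha> u + \<alpha> v"
  and dual_scale: "\<alpha> \<in> dual_space scale \<Longrightarrow> \<alpha> (scale c u) = c * \<alpha> u"
  by (auto simp: dual_space_def Vector_Spaces.linear_iff)

lemma dual_minus: "\<alpha> \<in> dual_space scale \<Longrightarrow> \<alpha> (- u) = - \<alpha> u"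
  using dual_scale[of \<alpha> "- 1" u] by simp

lemma dual_diff: "\<alpha> \<in> dual_space scale \<Longrightarrow> \<alpha> (u - v) = \<alpha> u - \<alpha> v"
  using dual_add[of \<alpha> u "- v"] by (simp add: dual_minus)

lemma dual_sum: "\<alpha> \<in> dual_space scale \<Longrightarrow> \<alpha> (sum f A) = (\<Sum>a\<in>A. \<alpha> (f a))"
proof -
  assume a: "\<alpha> \<in> dual_space scale"
  then have "\<alpha> 0 = 0" using dual_scale[OF a, of 0 0] by simp
  then show ?thesis by (induction A rule: infinite_finite_induct) (auto simp: dual_add[OF a])
qed

lemma formsI:
  assumes "\<And>xs ys u v. \<phi> (xs @ (u + v) # ys) = \<phi> (xs @ u # ys) + \<phi> (xs @ v # ys)"
    and "\<And>xs ys c u. \<phi> (xs @ scale c u # ys) = c * \<phi> (xs @ u # ys)"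
    and "\<And>xs. \<not> distinct xs \<Longrightarrow> \<phi> xs = 0"
  shows "\<phi> \<in> forms scale"
  using assms by (auto simp: alt_forms_def)

lemma forms_add_arg: "\<phi> \<in> forms scale \<Longrightarrow> \<phi> (xs @ (u + v) # ys) = \<phi> (xs @ u # ys) + \<phi> (xs @ v # ys)"
  and forms_scale_arg: "\<phi> \<in> forms scale \<Longrightarrow> \<phi> (xs @ scale c u # ys) = c * \<phi> (xs @ u # ys)"
  and forms_not_distinct: "\<phi> \<in> forms scale \<Longrightarrow> \<not> distinct xs \<Longrightarrow> \<phi> xs = 0"
  by (auto simp: alt_forms_def)

lemma forms_add: "\<phi> \<in> forms scale \<Longrightarrow> \<psi> \<in> forms scale \<Longrightarrow> \<phi> + \<psi> \<in> forms scale"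
  and forms_fscale: "\<phi> \<in> forms scale \<Longrightarrow> fscale c \<phi> \<in> forms scale"
  and forms_grade: "\<phi> \<in> forms scale \<Longrightarrow> grade \<phi> \<in> forms scale"
  by (auto simp: alt_forms_def fscale_def grade_def algebra_simps)

lemma forms_rev: "\<phi> \<in> forms scale \<Longrightarrow> rev_form \<phi> \<in> forms scale"
  by (intro formsI) (simp_all add: rev_form_def forms_add_arg forms_scale_arg forms_not_distinct)

lemma forms_int_prod: "\<phi> \<in> forms scale \<Longrightarrow> int_prod v \<phi> \<in> forms scale"
  using forms_add_arg[of \<phi> "v # _"] forms_scale_arg[of \<phi> "v # _"]
  by (intro formsI) (simp_all add: int_prod_def forms_not_distinct)

lemma forms_covector: "\<alpha> \<in> dual_space scale \<Longrightarrow> covector \<alpha> \<in> forms scale"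
  by (intro formsI)
    (auto simp: degree_one_def dual_add dual_scale append_eq_Cons_conv Cons_eq_append_conv split: list.splits)

lemma int_prod_add_arg: "\<phi> \<in> forms scale \<Longrightarrow> int_prod (u + v) \<phi> = int_prod u \<phi> + int_prod v \<phi>"
  and int_prod_scale_arg: "\<phi> \<in> forms scale \<Longrightarrow> int_prod (scale c u) \<phi> = fscale c (int_prod u \<phi>)"
  using forms_add_arg[of \<phi> "[]"] forms_scale_arg[of \<phi> "[]"]
  by (auto simp: int_prod_def fun_eq_iff fscale_def)

lemma int_prod_int_prod_self: "\<phi> \<in> forms scale \<Longrightarrow> int_prod v (int_prod v \<phi>) = 0"
  by (auto simp: int_prod_def fun_eq_iff forms_not_distinct)

lemma int_prod_anticommute:
  assumes "\<phi> \<in> forms scale"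
  shows "int_prod u (int_prod v \<phi>) = fscale (- 1) (int_prod v (int_prod u \<phi>))"
proof -
  have "int_prod (u + v) (int_prod (u + v) \<phi>) = 0" by (rule int_prod_int_prod_self[OF assms])
  then have "int_prod u (int_prod v \<phi>) + int_prod v (int_prod u \<phi>) = 0"
    using assms by (simp add: int_prod_add_arg forms_int_prod forms_add int_prod_add int_prod_int_prod_self
        add.commute)
  then show ?thesis by (auto simp: fun_eq_iff fscale_def eq_neg_iff_add_eq_0)
qed

lemma not_distinct_zero:
  assumes add: "\<And>xs ys u v. \<phi> (xs @ (u + v) # ys) = \<phi> (xs @ u # ys) + \<phi> (xs @ v # ys)"
    and adj: "\<And>xs ys u. \<phi> (xs @ u # u # ys) = (0 :: 'a)"
    and nd: "\<not> distinct xs"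
  shows "\<phi> xs = 0"
proof -
  have swap: "\<phi> (xs @ u # v # ys) = - \<phi> (xs @ v # u # ys)" for xs ys u v
  proof -
    have "0 = \<phi> (xs @ (u + v) # (u + v) # ys)" by (simp only: adj)
    also have "\<dots> = \<phi> (xs @ u # (u + v) # ys) + \<phi> (xs @ v # (u + v) # ys)" by (rule add)
    also have "\<dots> = \<phi> (xs @ u # v # ys) + \<phi> (xs @ v # u # ys)"
      using add[of "xs @ [u]" u v ys] add[of "xs @ [v]" u v ys] by (simp add: adj)
    finally show ?thesis by (simp add: eq_neg_iff_add_eq_0)
  qed
  have "\<phi> (xs @ u # ys @ u # zs) = 0" for xs ys zs u
  proof (induction ys arbitrary: xs)
    case Nil show ?case by (simp add: adj)
  next
    case (Cons y ys)
    show ?case using Cons.IH[of "xs @ [y]"] swap[of xs u y "ys @ u # zs"] by simp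
  qed
  with not_distinct_decomp[OF nd] show ?thesis by auto
qed

lemma forms_wedge:
  assumes "\<phi> \<in> forms scale" "\<psi> \<in> forms scale"
  shows "wedge \<phi> \<psi> \<in> forms scale"
proof -
  have add: "wedge \<phi> \<psi> (xs @ (u + v) # ys) = wedge \<phi> \<psi> (xs @ u # ys) + wedge \<phi> \<psi> (xs @ v # ys)"
    if "\<phi> \<in> forms scale" "\<psi> \<in> forms scale" for \<phi> \<psi> xs ys u v
    using that
    by (induction xs arbitrary: \<phi> \<psi>)
      (simp_all add: wedge_Cons int_prod_add_arg wedge_add_left wedge_add_right forms_int_prod forms_grade)
  have scl: "wedge \<phi> \<psi> (xs @ scale c u # ys) = c * wedge \<phi> \<psi> (xs @ u # ys)"
    if "\<phi> \<in> forms scale" "\<psi> \<in> forms scale" for \<phi> \<psi> xs ys u c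
    using that
  proof (induction xs arbitrary: \<phi> \<psi>)
    case Nil
    then have "wedge \<phi> \<psi> (scale c u # ys) =
        fscale c (wedge (int_prod u \<phi>) \<psi>) ys + fscale c (wedge (grade \<phi>) (int_prod u \<psi>)) ys"
      by (simp add: wedge_Cons int_prod_scale_arg wedge_scale_left wedge_scale_right)
    then show ?case by (simp add: wedge_Cons distrib_left) (simp add: fscale_def)
  qed (simp add: wedge_Cons forms_int_prod forms_grade distrib_left)
  have adj: "wedge \<phi> \<psi> (xs @ u # u # ys) = 0"
    if "\<phi> \<in> forms scale" "\<psi> \<in> forms scale" for \<phi> \<psi> xs ys u
    using that
  proof (induction xs arbitrary: \<phi> \<psi>)
    case Nil
    then have "wedge \<phi> \<psi> (u # u # ys) = wedge (grade (int_prod u \<phi>)) (int_prod u \<psi>) ys +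
        fscale (- 1) (wedge (grade (int_prod u \<phi>)) (int_prod u \<psi>)) ys"
      by (simp add: wedge_Cons int_prod_int_prod_self grade_int_prod wedge_scale_left)
    then show ?case by (simp add: fscale_def)
  qed (simp add: wedge_Cons forms_int_prod forms_grade)
  show ?thesis
    by (rule formsI, rule add[OF assms], rule scl[OF assms])
      (rule not_distinct_zero[of "wedge \<phi> \<psi>", OF add[OF assms] adj[OF assms]])
qed

abbreviation coord :: "'b \<Rightarrow> 'b \<Rightarrow> 'a" where
  "coord b v \<equiv> representation Basis v b"

lemma coord_dual: "coord b \<in> dual_space scale"
  using linear_representation[OF independent_Basis span_Basis] by (simp add: dual_space_def)

lemma coord_Basis: "b \<in> Basis \<Longrightarrow> coord c b = (if c = b then 1 else 0)"
  by (simp add: representation_basis[OF independent_Basis])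

lemma sum_coord: "(\<Sum>b\<in>Basis. scale (coord b v) b) = v"
  by (rule sum_representation_eq) (auto simp: independent_Basis span_Basis finite_Basis)

lemma int_prod_expand:
  assumes "\<phi> \<in> forms scale"
  shows "int_prod v \<phi> xs = (\<Sum>b\<in>Basis. coord b v * int_prod b \<phi> xs)"
proof -
  have "(\<lambda>v. int_prod v \<phi> xs) \<in> dual_space scale"
    using assms by (intro dualI) (simp_all add: int_prod_add_arg int_prod_scale_arg fscale_def)
  from dual_sum[OF this, of "\<lambda>b. scale (coord b v) b" Basis] dual_scale[OF this] show ?thesis
    by (simp add: sum_coord)
qed

text \<open>\<open>\<wedge>V\<^sup>*\<close> is generated by \<open>V\<^sup>*\<close>.\<close>

lemma forms_induct [consumes 1, case_names one add scale wedge]: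
  assumes "\<phi> \<in> forms scale"
    and one: "P ext_one"
    and add: "\<And>\<phi> \<psi>. \<phi> \<in> forms scale \<Longrightarrow> \<psi> \<in> forms scale \<Longrightarrow> P \<phi> \<Longrightarrow> P \<psi> \<Longrightarrow> P (\<phi> + \<psi>)"
    and scl: "\<And>c \<phi>. \<phi> \<in> forms scale \<Longrightarrow> P \<phi> \<Longrightarrow> P (fscale c \<phi>)"
    and wdg: "\<And>\<alpha> \<phi>. \<alpha> \<in> dual_space scale \<Longrightarrow> \<phi> \<in> forms scale \<Longrightarrow> P \<phi> \<Longrightarrow> P (wedge (covector \<alpha>) \<phi>)"
  shows "P \<phi>"
proof -
  have one_forms: "ext_one \<in> forms scale" by (intro formsI) (auto simp: ext_one_def)
  have gen: "P \<phi>" if "finite B" "B \<subseteq> Basis" "\<phi> \<in> forms scale" "\<And>c. c \<in> Basis - B \<Longrightarrow> int_prod c \<phi> = 0"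
    for B \<phi>
    using that
  proof (induction B arbitrary: \<phi> rule: finite_induct)
    case empty
    then have "int_prod v \<phi> xs = 0" for v xs by (subst int_prod_expand) auto
    then have "\<phi> (v # xs) = 0" for v xs by (simp add: int_prod_def)
    then have "\<phi> = fscale (\<phi> []) ext_one"
      by (auto simp: fun_eq_iff fscale_def ext_one_def neq_Nil_conv)
    then show ?case using scl[OF one_forms one] by metis
  next
    case (insert b B)
    have b: "b \<in> Basis" "b \<notin> B" using insert by auto
    let ?e = "wedge (covector (coord b)) (int_prod b \<phi>)"
    have in1: "int_prod b \<phi> \<in> forms scale" using insert by (simp add: forms_int_prod)
    have e: "?e \<in> forms scale" using in1 by (simp add: forms_wedge forms_covector coord_dual)
    let ?r = "\<phi> + fscale (- 1) ?e"
    have r: "?r \<in> forms scale" using e insert by (simp add: forms_add forms_fscale)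
    have z: "int_prod c (int_prod b \<phi>) = 0" if "c \<in> Basis - B" for c
    proof (cases "c = b")
      case False
      then have "int_prod c \<phi> = 0" using insert that by auto
      then show ?thesis using int_prod_anticommute[OF \<open>\<phi> \<in> forms scale\<close>, of c b]
        by simp (simp add: fun_eq_iff fscale_def)
    qed (simp add: int_prod_int_prod_self insert)
    have "P (int_prod b \<phi>)" using insert.IH[OF _ in1 z] insert.prems(1) by simp
    then have Pe: "P ?e" using in1 by (simp add: wdg coord_dual)
    have "int_prod c ?r = 0" if c: "c \<in> Basis - B" for c
    proof (cases "c = b")
      case True
      then show ?thesis using z[OF c] b
        by (simp add: int_prod_add int_prod_scale int_prod_covector_wedge coord_Basis)
          (simp add: fun_eq_iff fscale_def)
    next
      case False
      then have "int_prod c \<phi> = 0" using insert c by auto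
      then show ?thesis using z[OF c] b c False
        by (simp add: int_prod_add int_prod_scale int_prod_covector_wedge coord_Basis)
          (simp add: fun_eq_iff fscale_def)
    qed
    then have "P ?r" using insert.IH[OF _ r] insert.prems(1) by blast
    then have "P (?r + ?e)" using add[OF r e] Pe by blast
    moreover have "?r + ?e = \<phi>" by (simp add: fun_eq_iff fscale_def)
    ultimately show ?case by simp
  qed
  show ?thesis by (rule gen[OF finite_Basis subset_refl]) (use assms in auto)
qed

subsection \<open>The anti-automorphism\<close>

lemma is_transpose_rev: "is_transpose scale rev_form"
proof -
  have rr: "rev_form (rev_form f) = f" for f :: "'b list \<Rightarrow> 'a" by (simp add: fun_eq_iff rev_form_def)
  have "bij_betw rev_form (forms scale) (forms scale)"
    by (rule bij_betw_byWitness[of _ rev_form]) (auto simp: rr forms_rev)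
  moreover have "rev_form (covector \<alpha>) = covector \<alpha>" for \<alpha> :: "'b \<Rightarrow> 'a"
  proof
    show "rev_form (covector \<alpha>) xs = covector \<alpha> xs" for xs
      by (cases "length xs = 1")
        (auto simp: length_Suc_conv rev_form_def degree_one_def split: list.splits)
  qed
  ultimately show ?thesis
    by (simp add: is_transpose_def linear_endo_def forms_rev rev_form_wedge)
      (simp add: fun_eq_iff rev_form_def fscale_def ext_one_def)
qed

lemma is_transpose_unique:
  assumes "is_transpose scale T" "is_transpose scale T'" "\<phi> \<in> forms scale"
  shows "T \<phi> = T' \<phi>"
  using assms(3)
proof (induction rule: forms_induct)
  case one
  then show ?case using assms by (simp add: is_transpose_def)
qed (use assms in \<open>simp_all add: is_transpose_def linear_endo_def forms_covector del: plus_fun_apply\<close>)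

lemma is_transpose_form_transpose: "is_transpose scale (form_transpose scale)"
  unfolding form_transpose_def by (rule someI[of "is_transpose scale", OF is_transpose_rev])

lemma form_transpose_eq: "\<phi> \<in> forms scale \<Longrightarrow> form_transpose scale \<phi> xs = \<phi> (rev xs)"
  using is_transpose_unique[OF is_transpose_form_transpose is_transpose_rev] by (simp add: rev_form_def)

subsection \<open>The contraction by multivectors\<close>

primrec contr :: "'b list \<Rightarrow> (('b \<Rightarrow> 'a) list \<Rightarrow> 'a) \<Rightarrow> ('b list \<Rightarrow> 'a) \<Rightarrow> 'b list \<Rightarrow> 'a" where
  "contr [] \<xi> \<phi> = fscale (\<xi> []) \<phi>"
| "contr (b # bs) \<xi> \<phi> = contr bs \<xi> \<phi> + int_prod b (contr bs (int_prod (coord b) \<xi>) \<phi>)"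

lemma contr_forms: "\<phi> \<in> forms scale \<Longrightarrow> contr bs \<xi> \<phi> \<in> forms scale"
  by (induction bs arbitrary: \<xi>) (simp_all add: forms_fscale forms_add forms_int_prod)

lemma contr_add_left: "contr bs (\<xi> + \<eta>) \<phi> = contr bs \<xi> \<phi> + contr bs \<eta> \<phi>"
proof (induction bs arbitrary: \<xi> \<eta>)
  case Nil
  show ?case by (simp add: fun_eq_iff fscale_def distrib_right)
qed (simp add: int_prod_add add_ac del: plus_fun_apply)

lemma contr_scale_left: "contr bs (fscale c \<xi>) \<phi> = fscale c (contr bs \<xi> \<phi>)"
proof (induction bs arbitrary: \<xi>)
  case Nil
  show ?case by (simp add: fun_eq_iff fscale_def mult_ac)
qed (simp add: int_prod_scale fscale_add del: plus_fun_apply)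

lemma contr_add_right: "contr bs \<xi> (\<phi> + \<psi>) = contr bs \<xi> \<phi> + contr bs \<xi> \<psi>"
  by (induction bs arbitrary: \<xi>) (simp_all add: int_prod_add fscale_add add_ac del: plus_fun_apply)

lemma contr_scale_right: "contr bs \<xi> (fscale c \<phi>) = fscale c (contr bs \<xi> \<phi>)"
proof (induction bs arbitrary: \<xi>)
  case Nil
  show ?case by (simp add: fun_eq_iff fscale_def mult_ac)
qed (simp add: int_prod_scale fscale_add del: plus_fun_apply)

lemma contr_int_prod:
  assumes "\<phi> \<in> forms scale"
  shows "contr bs \<xi> (int_prod v \<phi>) = int_prod v (contr bs (grade \<xi>) \<phi>)"
proof (induction bs arbitrary: \<xi>)
  case Nil
  show ?case by (simp add: int_prod_scale grade_def)
next
  case (Cons b bs)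
  have "int_prod b (int_prod v (contr bs (grade (int_prod (coord b) \<xi>)) \<phi>))
      = fscale (- 1) (int_prod v (int_prod b (contr bs (grade (int_prod (coord b) \<xi>)) \<phi>)))"
    by (rule int_prod_anticommute) (simp add: contr_forms assms)
  then show ?case
    by (simp add: Cons.IH int_prod_add grade_int_prod contr_scale_left int_prod_scale del: plus_fun_apply)
qed

lemma contr_wedge:
  assumes "\<phi> \<in> forms scale"
  shows "contr bs (wedge \<xi> \<eta>) \<phi> = contr bs \<xi> (contr bs \<eta> \<phi>)"
proof (induction bs arbitrary: \<xi> \<eta>)
  case Nil
  show ?case by (simp add: fun_eq_iff fscale_def algebra_simps)
next
  case (Cons b bs)
  let ?x = "int_prod (coord b)"
  have "int_prod b (int_prod b (contr bs (grade (?x \<xi>)) (contr bs (?x \<eta>) \<phi>))) = 0"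
    by (simp add: int_prod_int_prod_self contr_forms assms)
  then show ?case
    by (simp add: Cons.IH int_prod_wedge contr_add_left contr_add_right int_prod_add
        contr_int_prod contr_forms assms add_ac del: plus_fun_apply zero_fun_apply)
qed

lemma contr_one: "contr bs ext_one \<phi> = \<phi>"
proof -
  have z: "contr bs 0 \<phi> = 0" for bs :: "'b list"
    by (induction bs) (simp_all del: zero_fun_apply plus_fun_apply, simp add: fscale_def fun_eq_iff)
  show ?thesis by (induction bs) (simp_all add: z, simp add: fun_eq_iff fscale_def ext_one_def)
qed

lemma contr_vec:
  assumes "\<phi> \<in> forms scale"
  shows "contr bs (bidual_vec scale v) \<phi> xs = (\<Sum>b\<leftarrow>bs. coord b v * int_prod b \<phi> xs)"
proof (induction bs)
  case Nil
  show ?case by (simp add: degree_one_def fscale_def)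
next
  case (Cons b bs)
  have "int_prod (coord b) (bidual_vec scale v) = fscale (coord b v) ext_one"
    by (auto simp: int_prod_def fun_eq_iff degree_one_def fscale_def ext_one_def coord_dual
        split: list.splits)
  then show ?case using Cons
    by (simp add: contr_scale_left contr_one int_prod_scale) (simp add: fscale_def)
qed

lemma ex_is_contraction: "\<exists>\<iota>. is_contraction scale \<iota>"
proof -
  obtain bs where bs: "set bs = Basis" "distinct bs"
    using finite_distinct_list[OF finite_Basis] by blast
  have "contr bs (bidual_vec scale v) \<phi> = int_prod v \<phi>" if "\<phi> \<in> forms scale" for v \<phi>
    by (rule ext) (simp only: contr_vec[OF that] sum_list_distinct_conv_sum_set[OF bs(2)] bs(1)
        int_prod_expand[OF that, of v])
  then have "is_contraction scale (contr bs)"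
    by (simp add: is_contraction_def linear_endo_def contr_forms contr_add_left contr_add_right
        contr_scale_left contr_scale_right contr_wedge contr_one del: plus_fun_apply)
  then show ?thesis by (rule exI[of "is_contraction scale"])
qed

lemma is_contraction_contraction: "is_contraction scale (contraction scale)"
  unfolding contraction_def by (rule someI_ex[of "is_contraction scale", OF ex_is_contraction])

subsection \<open>The bivector of a splitting\<close>

lemma dual_separates: "(\<And>\<beta>. \<beta> \<in> dual_space scale \<Longrightarrow> \<beta> u = \<beta> v) \<Longrightarrow> u = v"
proof -
  assume "\<And>\<beta>. \<beta> \<in> dual_space scale \<Longrightarrow> \<beta> u = \<beta> v"
  then have "coord b u = coord b v" for b using coord_dual by blast
  then have "(\<Sum>b\<in>Basis. scale (coord b u) b) = (\<Sum>b\<in>Basis. scale (coord b v) b)" by simp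
  then show "u = v" by (simp only: sum_coord)
qed

lemma module_double: "module (double_scale scale)"
  by unfold_locales
    (simp_all add: double_scale_def fscale_def fun_eq_iff distrib_left distrib_right mult.assoc
      scale_left_distrib scale_right_distrib)

lemma proj_along_add:
  assumes EF: "lagrangian_splitting scale E F" and e: "e \<in> E" and f: "f \<in> F"
  shows "proj_along E F (e + f) = e"
proof -
  interpret d: module "double_scale scale" by (rule module_double)
  have sub: "d.subspace E" "d.subspace F" and int: "E \<inter> F = {0}"
    using EF unfolding lagrangian_splitting_def lagrangian_def by blast+
  show ?thesis
    unfolding proj_along_def
  proof (rule the_equality)
    fix e' assume "e' \<in> E \<and> (\<exists>f'\<in>F. e + f = e' + f')"
    then obtain f' where e': "e' \<in> E" "f' \<in> F" "e + f = e' + f'" by blast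
    have "f = e' + f' - e" using e'(3) by (metis add_diff_cancel_left')
    then have "e' - e = f - f'" by (simp add: algebra_simps)
    then have "e' - e \<in> E \<inter> F"
      using d.subspace_diff[OF sub(1) e'(1) e] d.subspace_diff[OF sub(2) f e'(2)] by simp
    then show "e' = e" using int by simp
  qed (use e f in blast)
qed

lemma proj_along_splitting:
  assumes EF: "lagrangian_splitting scale E F" and w: "w \<in> double_space scale"
  shows "proj_along E F w \<in> E" "w - proj_along E F w \<in> F"
proof -
  have "w \<in> {e + f | e f. e \<in> E \<and> f \<in> F}"
    using EF w unfolding lagrangian_splitting_def by blast
  then obtain e f where "e \<in> E" "f \<in> F" "w = e + f" by blast
  then show "proj_along E F w \<in> E" "w - proj_along E F w \<in> F"
    using proj_along_add[OF EF, of e f] by simp_all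
qed

lemma sharp_splitting_bivector:
  assumes "\<alpha> \<in> dual_space scale"
  shows "sharp scale (splitting_bivector scale E F) \<alpha> = - fst (proj_along E F (0, \<alpha>))"
  unfolding sharp_def
proof (rule the_equality)
  show "\<forall>\<beta>\<in>dual_space scale.
      \<beta> (- fst (proj_along E F (0, \<alpha>))) = splitting_bivector scale E F [\<alpha>, \<beta>]"
    by (simp add: splitting_bivector_def assms)
  show "v = - fst (proj_along E F (0, \<alpha>))"
    if "\<forall>\<beta>\<in>dual_space scale. \<beta> v = splitting_bivector scale E F [\<alpha>, \<beta>]" for v
    by (rule dual_separates) (use that in \<open>simp add: splitting_bivector_def assms\<close>)
qed

lemma splitting_bivector_multivector:
  assumes EF: "lagrangian_splitting scale E F" and two: "(2 :: 'a) \<noteq> 0"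
  shows "splitting_bivector scale E F \<in> multivectors scale"
    and "length xs \<noteq> 2 \<Longrightarrow> splitting_bivector scale E F xs = 0"
proof -
  interpret d: module "double_scale scale" by (rule module_double)
  have lag: "d.subspace E" "d.subspace F" "E = perp scale E" "F = perp scale F"
    using EF by (auto simp: lagrangian_splitting_def lagrangian_def)
  have subE: "E \<subseteq> double_space scale"
    using EF by (simp add: lagrangian_splitting_def lagrangian_def)
  let ?p = "\<lambda>\<alpha>. proj_along E F (0, \<alpha>)"
  let ?\<pi> = "splitting_bivector scale E F"
  note p = proj_along_splitting[OF EF]
  have dbl: "(0, \<alpha>) \<in> double_space scale" if "\<alpha> \<in> dual_space scale" for \<alpha>
    using that by (simp add: double_space_def)
  have add_dual: "\<alpha> + \<beta> \<in> dual_space scale" if "\<alpha> \<in> dual_space scale" "\<beta> \<in> dual_space scale" for \<alpha> \<beta>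
    using that by (intro dualI) (simp_all add: dual_add dual_scale algebra_simps)
  have scale_dual: "fscale c \<alpha> \<in> dual_space scale" if "\<alpha> \<in> dual_space scale" for c \<alpha>
    using that by (intro dualI) (simp_all add: dual_add dual_scale fscale_def algebra_simps)
  have p_add: "?p (\<alpha> + \<beta>) = ?p \<alpha> + ?p \<beta>" if "\<alpha> \<in> dual_space scale" "\<beta> \<in> dual_space scale" for \<alpha> \<beta>
  proof -
    have "?p \<alpha> + ?p \<beta> \<in> E" "((0, \<alpha>) - ?p \<alpha>) + ((0, \<beta>) - ?p \<beta>) \<in> F"
      using that lag p(1,2)[OF dbl] by (auto intro: d.subspace_add)
    from proj_along_add[OF EF this] show ?thesis by (simp add: algebra_simps)
  qed
  have p_scale: "?p (fscale c \<alpha>) = double_scale scale c (?p \<alpha>)" if "\<alpha> \<in> dual_space scale" for c \<alpha>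
  proof -
    have "double_scale scale c (?p \<alpha>) \<in> E" "double_scale scale c ((0, \<alpha>) - ?p \<alpha>) \<in> F"
      using that lag p(1,2)[OF dbl] by (auto intro: d.subspace_scale)
    from proj_along_add[OF EF this] show ?thesis
      by (simp add: d.scale_right_diff_distrib) (simp add: double_scale_def)
  qed
  have iso: "\<alpha> (- fst (?p \<alpha>)) = 0" if \<alpha>: "\<alpha> \<in> dual_space scale" for \<alpha>
  proof -
    let ?e = "?p \<alpha>" and ?f = "(0, \<alpha>) - ?p \<alpha>"
    have e: "?e \<in> E" and f: "?f \<in> F" using p(1,2)[OF dbl[OF \<alpha>]] by auto
    have "pairing ?e ?e = 0" "pairing ?f ?f = 0" using e f lag(3,4) unfolding perp_def by blast+
    moreover have "snd ?e \<in> dual_space scale" using e subE by (auto simp: double_space_def)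
    ultimately have "2 * \<alpha> (fst ?e) = 0"
      using \<alpha> two by (simp add: pairing_def dual_minus)
    then show ?thesis using \<alpha> two by (simp add: dual_minus)
  qed
  show zero: "?\<pi> xs = 0" if "length xs \<noteq> 2" for xs
    using that by (auto simp: splitting_bivector_def split: list.splits)
  have \<pi>2: "?\<pi> [\<alpha>, \<beta>] = \<beta> (- fst (?p \<alpha>))" if "\<alpha> \<in> dual_space scale" "\<beta> \<in> dual_space scale" for \<alpha> \<beta>
    using that by (simp add: splitting_bivector_def)
  have len2: "length xs = 2 \<longleftrightarrow> (\<exists>\<alpha> \<beta>. xs = [\<alpha>, \<beta>])" for xs :: "('b \<Rightarrow> 'a) list"
    by (auto simp: numeral_2_eq_2 length_Suc_conv)
  have lin: "?\<pi> (xs @ (u + v) # ys) = ?\<pi> (xs @ u # ys) + ?\<pi> (xs @ v # ys) \<and>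
      ?\<pi> (xs @ fscale c u # ys) = c * ?\<pi> (xs @ u # ys)"
    if "xs \<in> lists (dual_space scale)" "ys \<in> lists (dual_space scale)"
      "u \<in> dual_space scale" "v \<in> dual_space scale" for xs ys u v c
  proof (cases "length xs + length ys = 1")
    case False
    then show ?thesis by (simp add: zero)
  next
    case True
    then consider \<beta> where "xs = []" "ys = [\<beta>]" | \<beta> where "xs = [\<beta>]" "ys = []"
      by (auto simp: add_is_1 length_Suc_conv)
    then show ?thesis
    proof cases
      case 1
      with that show ?thesis
        by (simp add: \<pi>2 add_dual scale_dual p_add p_scale dual_minus dual_diff dual_add)
          (simp add: double_scale_def dual_scale)
    next
      case 2
      with that show ?thesis
        by (simp add: \<pi>2 add_dual scale_dual) (simp add: fscale_def)
    qed
  qed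
  have alt: "?\<pi> xs = 0" if "xs \<in> lists (dual_space scale)" "\<not> distinct xs" for xs
  proof (cases "length xs = 2")
    case True
    then show ?thesis using that iso by (auto simp: len2 \<pi>2)
  qed (simp add: zero)
  have out: "?\<pi> xs = 0" if "xs \<notin> lists (dual_space scale)" for xs
  proof (cases "length xs = 2")
    case True
    then show ?thesis using that by (auto simp: len2 splitting_bivector_def split: if_splits)
  qed (simp add: zero)
  show "?\<pi> \<in> multivectors scale"
    unfolding alt_forms_def using lin alt out by blast
qed

end

end

theory Submission
  imports Defs
begin

text \<open>
  For \<open>\<alpha> \<in> V\<^sup>*\<close>, decomposing \<open>\<alpha> = e + f\<close> with \<open>e \<in> E\<close>, \<open>f \<in> F\<close> gives
  \<open>\<pi>\<^sup>\<sharp>(\<alpha>) = - pr\<^sub>V e = pr\<^sub>V f\<close>, so \<open>- e\<close> and \<open>f\<close> lie over the same vector and the difference of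
  their \<open>V\<^sup>*\<close>-parts is \<open>\<alpha>\<close>. For the spinors, \<open>\<chi> = \<phi>\<^sup>\<top> \<and> \<psi>\<close> is annihilated by every
  \<open>\<pi>\<^sup>\<sharp>(\<alpha>) \<oplus> \<alpha>\<close>. The commutation relation \<open>[\<iota>(\<pi>), \<alpha> \<and>] = - \<iota>(\<pi>\<^sup>\<sharp>(\<alpha>))\<close> shows that
  \<open>\<omega> = exp(- \<iota>(\<pi>)) \<chi>\<^sub>t\<^sub>o\<^sub>p\<close> is annihilated too. So is \<open>\<chi> - \<omega>\<close>, whose top degree part is
  \<open>0\<close>; comparing degrees, its highest nonzero component would be killed by all \<open>\<alpha> \<and>\<close>, which is
  impossible below the top degree, and hence \<open>\<chi> = \<omega>\<close>.
\<close>

section \<open>Alternating forms\<close>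

lemma wedge_one_right [simp]: "wedge \<phi> ext_one = \<phi>"
proof
  show "wedge \<phi> ext_one xs = \<phi> xs" for xs
    by (induction xs arbitrary: \<phi>) (simp_all add: wedge_Cons, simp_all add: ext_one_def int_prod_def)
qed

text \<open>Induction on the argument list: peeling off the first vector costs the left side one
  sign, and \<open>grade_int_prod\<close> produces the same sign in each term of the Leibniz rule on
  the right.\<close>

lemma grade_wedge: "grade (wedge \<phi> \<psi>) = wedge (grade \<phi>) (grade \<psi>)"
proof
  show "grade (wedge \<phi> \<psi>) xs = wedge (grade \<phi>) (grade \<psi>) xs" for xs
  proof (induction xs arbitrary: \<phi> \<psi>)
    case (Cons x xs)
    have "grade (wedge \<phi> \<psi>) (x # xs) = int_prod x (grade (wedge \<phi> \<psi>)) xs"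
      by (simp add: int_prod_def)
    also have "\<dots> = - (grade (wedge (int_prod x \<phi>) \<psi>) xs + grade (wedge (grade \<phi>) (int_prod x \<psi>)) xs)"
      by (simp add: grade_int_prod int_prod_wedge grade_add) (simp add: fscale_def)
    finally show ?case
      by (simp add: Cons.IH wedge_Cons grade_int_prod wedge_scale_left wedge_scale_right)
        (simp add: fscale_def)
  qed (simp add: grade_def)
qed

text \<open>The Leibniz rule \<open>int_prod_wedge\<close> reduces both sides to a shorter list;
  \<open>grade_wedge\<close> matches the terms in which the contraction has passed two
  factors.\<close>

lemma wedge_assoc: "wedge (wedge \<phi> \<psi>) \<chi> = wedge \<phi> (wedge \<psi> \<chi>)"
proof
  show "wedge (wedge \<phi> \<psi>) \<chi> xs = wedge \<phi> (wedge \<psi> \<chi>) xs" for xs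
    by (induction xs arbitrary: \<phi> \<psi> \<chi>)
      (simp_all add: mult.assoc wedge_Cons int_prod_wedge grade_wedge wedge_add_left wedge_add_right
        add.assoc)
qed

text \<open>Graded commutativity: \<open>grade\<close> supplies the sign for moving a covector past
  \<phi>.\<close>

lemma wedge_grade_covector: "wedge (grade \<phi>) (covector \<alpha>) = wedge (covector \<alpha>) \<phi>"
  for \<phi> :: "'v list \<Rightarrow> 'k::comm_ring_1"
proof
  show "wedge (grade \<phi>) (covector \<alpha>) xs = wedge (covector \<alpha>) \<phi> xs" for xs
  proof (induction xs arbitrary: \<phi>)
    case (Cons x xs)
    show ?case
      by (simp add: wedge_Cons grade_int_prod wedge_scale_left int_prod_covector grade_covector
          wedge_scale_right) (simp add: fscale_def Cons.IH)
  qed (simp add: degree_one_def)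
qed

lemma wedge_covector_Cons:
  "wedge (covector \<alpha>) \<phi> (v # xs) = \<alpha> v * \<phi> xs - wedge (covector \<alpha>) (int_prod v \<phi>) xs"
  for \<alpha> :: "'v \<Rightarrow> 'k::comm_ring_1"
  by (simp add: wedge_Cons int_prod_covector grade_covector wedge_scale_left) (simp add: fscale_def)

text \<open>A covector consumes exactly one argument, so in degree \<open>m + 1\<close> the product
  sees only the degree \<open>m\<close> component of \<phi>.\<close>

lemma wedge_covector_eq_0_at:
  fixes \<phi> :: "'v list \<Rightarrow> 'k::comm_ring_1"
  assumes "\<And>ys. length ys = m \<Longrightarrow> \<phi> ys = 0" and "length xs = Suc m"
  shows "wedge (covector \<alpha>) \<phi> xs = 0"
  using assms
proof (induction m arbitrary: xs \<phi>)
  case 0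
  then obtain y where "xs = [y]" by (auto simp: length_Suc_conv)
  then show ?case using 0(1) by (simp add: wedge_covector_Cons) (simp add: degree_one_def)
next
  case (Suc m)
  then obtain y ys where xs: "xs = y # ys" "length ys = Suc m" by (auto simp: length_Suc_conv)
  have "wedge (covector \<alpha>) (int_prod y \<phi>) ys = 0"
    by (rule Suc.IH) (use Suc.prems xs in \<open>simp_all add: int_prod_def\<close>)
  with Suc.prems xs show ?case by (simp add: wedge_covector_Cons)
qed

lemma wedge_sum_right: "wedge \<phi> (\<Sum>i\<in>I. f i) = (\<Sum>i\<in>I. wedge \<phi> (f i))"
  by (induction I rule: infinite_finite_induct) (simp_all add: wedge_add_right del: plus_fun_apply zero_fun_apply)

lemma int_prod_sum: "int_prod v (\<Sum>i\<in>I. f i) = (\<Sum>i\<in>I. int_prod v (f i))"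
  for f :: "'i \<Rightarrow> 'w list \<Rightarrow> 'k::comm_ring_1"
  by (induction I rule: infinite_finite_induct) (simp_all add: int_prod_add del: plus_fun_apply zero_fun_apply)

lemma sum_fun_apply: "(\<Sum>i\<in>I. f i) x = (\<Sum>i\<in>I. f i x)" 
  for f :: "'i \<Rightarrow> 'x \<Rightarrow> 'k::comm_monoid_add"
  by (induction I rule: infinite_finite_induct) simp_all

lemma fscale_sum: "fscale c (\<Sum>i\<in>I. f i) = (\<Sum>i\<in>I. fscale c (f i))" for c :: "'k::comm_ring_1"
  by (simp add: fun_eq_iff fscale_def sum_fun_apply sum_distrib_left)

lemma fscale_fscale: "fscale c (fscale d f) = fscale (c * d) f" for c :: "'k::comm_ring_1"
  by (simp add: fun_eq_iff fscale_def mult.assoc)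

section \<open>Vanishing by degree, reversal and the Clifford action\<close>

context finite_dimensional_vector_space
begin

lemma forms_0: "0 \<in> forms scale"
  by (intro formsI) simp_all

lemma forms_sum: "(\<And>i. i \<in> I \<Longrightarrow> f i \<in> forms scale) \<Longrightarrow> (\<Sum>i\<in>I. f i) \<in> forms scale"
  by (induction I rule: infinite_finite_induct) (simp_all add: forms_0 forms_add del: plus_fun_apply zero_fun_apply)

text \<open>The induction keeps a set \<open>B\<close> of basis vectors outside of which every
  contraction kills \<phi>. Contracting with an element of \<open>B\<close> uses up one argument and
  removes that element from \<open>B\<close>, so the arguments always outnumber
  \<open>B\<close>.\<close>

lemma forms_eq_0_above_dim:
  assumes "\<phi> \<in> forms scale" "dim UNIV < length xs"
  shows "\<phi> xs = 0"
proof -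
  have "\<phi> xs = 0"
    if "B \<subseteq> Basis" "\<phi> \<in> forms scale" "card B < length xs" "\<And>c. c \<in> Basis - B \<Longrightarrow> int_prod c \<phi> = 0"
    for B \<phi>
    using that
  proof (induction xs arbitrary: B \<phi>)
    case (Cons x xs)
    have "int_prod b \<phi> xs = 0" if b: "b \<in> Basis" for b
    proof (cases "b \<in> B")
      case True
      show ?thesis
      proof (rule Cons.IH)
        show "B - {b} \<subseteq> Basis" "int_prod b \<phi> \<in> forms scale"
          using Cons.prems by (auto simp: forms_int_prod)
        have "finite B" using Cons.prems(1) finite_Basis finite_subset by blast
        then show "card (B - {b}) < length xs"
          using Cons.prems(3) card_Diff1_less[of B b] True by simp
        show "int_prod c (int_prod b \<phi>) = 0" if "c \<in> Basis - (B - {b})" for c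
        proof (cases "c = b")
          case False
          then have "int_prod c \<phi> = 0" using Cons.prems(4) that by auto
          then show ?thesis using int_prod_anticommute[OF Cons.prems(2), of c b]
            by simp (simp add: fun_eq_iff fscale_def)
        qed (simp add: int_prod_int_prod_self Cons.prems)
      qed
    next
      case False
      then show ?thesis using Cons.prems(4) b by simp
    qed
    then have "int_prod x \<phi> xs = 0" by (subst int_prod_expand[OF Cons.prems(2)]) simp
    then show ?case by (simp add: int_prod_def)
  qed simp
  from this[of Basis] assms show ?thesis by (simp add: dim_UNIV)
qed

text \<open>For a basis vector b with dual covector b', the relation \<iota>(b)(b' \<and> \<phi>) =
  \<phi> - b' \<and> \<iota>(b)\<phi> recovers the degree \<open>k\<close> part of \<phi> from
  \<iota>(b)\<phi>, one degree lower. The other dual basis covectors vanish on b, so their products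
  still kill \<iota>(b)\<phi>; this allows induction over a list of more than \<open>k\<close>
  distinct basis vectors.\<close>

lemma forms_eq_0_if_wedge_covector:
  assumes "\<phi> \<in> forms scale" "length xs = k" "k < dim UNIV"
    and "\<And>\<alpha> ys. \<alpha> \<in> dual_space scale \<Longrightarrow> length ys = Suc k \<Longrightarrow> wedge (covector \<alpha>) \<phi> ys = 0"
  shows "\<phi> xs = 0"
proof -
  have "\<phi> xs = 0"
    if "set bs \<subseteq> Basis" "distinct bs" "\<phi> \<in> forms scale" "k < length bs" "length xs = k"
      "\<And>b ys. b \<in> set bs \<Longrightarrow> length ys = Suc k \<Longrightarrow> wedge (covector (coord b)) \<phi> ys = 0"
    for bs \<phi> xs
    using that
  proof (induction bs arbitrary: \<phi> xs k)
    case (Cons b bs)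
    have rel: "wedge (covector \<alpha>) (int_prod b \<phi>) ys = \<alpha> b * \<phi> ys - wedge (covector \<alpha>) \<phi> (b # ys)" for \<alpha> ys
      by (simp add: wedge_covector_Cons)
    have "wedge (covector (coord b)) (int_prod b \<phi>) xs = 0"
    proof (cases k)
      case 0
      with Cons.prems show ?thesis by (simp add: degree_one_def)
    next
      case (Suc m)
      show ?thesis
      proof (rule wedge_covector_eq_0_at)
        show "length xs = Suc m" using Suc Cons.prems by simp
        show "int_prod b \<phi> ys = 0" if "length ys = m" for ys
        proof (rule Cons.IH)
          show "wedge (covector (coord c)) (int_prod b \<phi>) zs = 0" if "c \<in> set bs" "length zs = Suc m" for c zs
            using that Cons.prems Suc by (auto simp: rel coord_Basis)
        qed (use that Cons.prems Suc in \<open>auto simp: forms_int_prod\<close>)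
      qed
    qed
    with Cons.prems show ?case by (simp add: rel coord_Basis)
  qed simp
  moreover obtain bs where bs: "set bs = Basis" "distinct bs"
    using finite_distinct_list[OF finite_Basis] by blast
  moreover have "k < length bs"
    using assms(3) bs distinct_card[of bs] by (simp add: dim_UNIV)
  ultimately show ?thesis
    using assms coord_dual by blast
qed

text \<open>Moving the last argument to the front passes every other argument once, each at the cost
  of a sign. This is needed because reversal turns contraction in the first slot into contraction in
  the last.\<close>

lemma rinterior_eq_grade:
  assumes "\<phi> \<in> forms scale"
  shows "rinterior v \<phi> = grade (int_prod v \<phi>)"
proof
  show "rinterior v \<phi> xs = grade (int_prod v \<phi>) xs" for xs
    using assms
  proof (induction xs arbitrary: \<phi>)
    case (Cons x xs)
    have "rinterior v \<phi> (x # xs) = rinterior v (int_prod x \<phi>) xs"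
      by (simp add: rinterior_def int_prod_def)
    also have "\<dots> = grade (int_prod v (int_prod x \<phi>)) xs"
      using Cons by (simp add: forms_int_prod)
    also have "\<dots> = grade (int_prod v \<phi>) (x # xs)"
      by (simp only: int_prod_anticommute[OF Cons.prems, of v x])
        (simp add: grade_def fscale_def int_prod_def)
    finally show ?case .
  qed (simp add: rinterior_def grade_def int_prod_def)
qed

text \<open>Reversal turns \<iota>(v)\<phi> = - \<alpha> \<and> \<phi> into right multiplication of
  the graded transpose by \<alpha>. The Leibniz rule and graded commutation then show that
  contracting the product with v gives its left multiple by \<alpha> - \<beta>.\<close>

lemma clifford_action_transpose_wedge:
  assumes "\<phi> \<in> forms scale" "\<alpha> \<in> dual_space scale"
    and \<phi>: "clifford_action (v, \<alpha>) \<phi> = 0" and \<psi>: "clifford_action (v, \<beta>) \<psi> = 0"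
  shows "clifford_action (v, \<beta> - \<alpha>) (wedge (form_transpose scale \<phi>) \<psi>) = 0"
proof -
  have T: "form_transpose scale \<phi> = rev_form \<phi>"
    by (simp add: fun_eq_iff form_transpose_eq[OF assms(1)] rev_form_def)
  let ?T = "rev_form \<phi>" and ?\<chi> = "wedge (rev_form \<phi>) \<psi>"
  have neg: "int_prod v \<theta> = fscale (- 1) (wedge (covector \<gamma>) \<theta>)" if "clifford_action (v, \<gamma>) \<theta> = 0"
    for \<gamma> and \<theta> :: "'b list \<Rightarrow> 'a"
    using that by (simp add: clifford_action_def fun_eq_iff fscale_def) (simp add: add_eq_0_iff)
  have rcov: "rev_form (covector \<alpha>) = covector \<alpha>"
    using is_transpose_rev assms(2) by (simp add: is_transpose_def)
  have grade_rev: "rev_form (grade \<phi>) = grade ?T"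
    by (simp add: fun_eq_iff grade_def rev_form_def)
  have "int_prod v ?T = rev_form (rinterior v \<phi>)"
    by (simp add: fun_eq_iff int_prod_def rinterior_def rev_form_def)
  \<comment> \<open>The sign from \<open>neg\<close> cancels the sign of \<open>grade\<close> on the
    covector.\<close>
  also have "\<dots> = rev_form (wedge (covector \<alpha>) (grade \<phi>))"
    by (simp add: rinterior_eq_grade[OF assms(1)] neg[OF \<phi>] grade_wedge grade_covector grade_scale
        wedge_scale_left) (simp add: fscale_def)
  also have "\<dots> = wedge (grade ?T) (covector \<alpha>)"
    by (simp only: rev_form_wedge rcov grade_rev)
  finally have "int_prod v ?\<chi> = wedge (covector \<alpha>) ?\<chi> + fscale (- 1) (wedge (covector \<beta>) ?\<chi>)"
    by (simp only: int_prod_wedge neg[OF \<psi>] wedge_scale_right wedge_assoc[symmetric] wedge_grade_covector)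
  moreover have "covector (\<beta> - \<alpha>) = covector \<beta> + fscale (- 1) (covector \<alpha>)"
    by (auto simp: fun_eq_iff degree_one_def fscale_def split: list.splits)
  ultimately have "clifford_action (v, \<beta> - \<alpha>) ?\<chi> = wedge (covector \<beta>) ?\<chi> + fscale (- 1) (wedge (covector \<alpha>) ?\<chi>)
      + (wedge (covector \<alpha>) ?\<chi> + fscale (- 1) (wedge (covector \<beta>) ?\<chi>))"
    by (simp only: clifford_action_def fst_conv snd_conv wedge_add_left wedge_scale_left)
  also have "\<dots> = 0" by (rule ext) (simp add: fscale_def)
  finally show ?thesis by (simp only: T)
qed

end

section \<open>Contraction by a bivector\<close>

text \<open>Contraction by the bivector \<open>1/2 \<Sum>\<^sub>b b \<and> u(b)\<close>; every bivector has this form, with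
  \<open>u(b) = \<pi>\<^sup>\<sharp>(b\<^sup>*)\<close> for the basis \<open>b\<^sup>*\<close> dual to \<open>B\<close>.\<close>

definition bicontraction :: "('v \<Rightarrow> 'v) \<Rightarrow> 'v set \<Rightarrow> ('v list \<Rightarrow> 'k) \<Rightarrow> 'v list \<Rightarrow> 'k::field" where
  "bicontraction u B \<phi> = fscale (1 / 2) (\<Sum>b\<in>B. int_prod b (int_prod (u b) \<phi>))"

text \<open>This encodes the sharp map of a bivector. Linearity on the dual space is implied:
  \<beta>(s \<alpha>) = - \<alpha>(s \<beta>) is linear in \<alpha>, and covectors separate
  points.\<close>

definition skew_map :: "('k::field \<Rightarrow> 'v::ab_group_add \<Rightarrow> 'v) \<Rightarrow> (('v \<Rightarrow> 'k) \<Rightarrow> 'v) \<Rightarrow> bool" where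
  "skew_map scale s \<longleftrightarrow> (\<forall>\<alpha>\<in>dual_space scale. \<forall>\<beta>\<in>dual_space scale. \<beta> (s \<alpha>) = - \<alpha> (s \<beta>))"

section \<open>Bivectors as sums of products of vectors, and the commutation relation\<close>

context finite_dimensional_vector_space
begin

lemma fscale_dual: "\<alpha> \<in> dual_space scale \<Longrightarrow> fscale c \<alpha> \<in> dual_space scale"
  by (intro dualI) (simp_all add: dual_add dual_scale fscale_def algebra_simps)

lemma add_dual: "\<alpha> \<in> dual_space scale \<Longrightarrow> \<beta> \<in> dual_space scale \<Longrightarrow> \<alpha> + \<beta> \<in> dual_space scale"
  by (intro dualI) (simp_all add: dual_add dual_scale algebra_simps)

lemma wedge_bidual_vec:
  "wedge (bidual_vec scale u) (bidual_vec scale v) xs =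
    (case xs of [\<alpha>, \<beta>] \<Rightarrow> if \<alpha> \<in> dual_space scale \<and> \<beta> \<in> dual_space scale
        then \<alpha> u * \<beta> v - \<beta> u * \<alpha> v else 0 | _ \<Rightarrow> 0)"
proof -
  have ip: "int_prod \<alpha> (bidual_vec scale u) = fscale (if \<alpha> \<in> dual_space scale then \<alpha> u else 0) ext_one" for \<alpha> u
    by (auto simp: int_prod_def fun_eq_iff degree_one_def fscale_def ext_one_def split: list.splits)
  have g: "grade (bidual_vec scale u) = fscale (- 1) (bidual_vec scale u)" for u
    by (auto simp: grade_def fun_eq_iff degree_one_def fscale_def split: list.splits)
  show ?thesis
    by (cases xs; cases "tl xs"; cases "tl (tl xs)")
      (auto simp: wedge_Cons ip g wedge_scale_left wedge_scale_right,
       auto simp: fscale_def degree_one_def)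
qed

lemma wedge_bidual_vec_multivector:
  "wedge (bidual_vec scale u) (bidual_vec scale v) \<in> multivectors scale"
proof -
  let ?w = "wedge (bidual_vec scale u) (bidual_vec scale v)"
  have zero: "?w xs = 0" if "length xs \<noteq> 2" for xs
    using that by (auto simp: wedge_bidual_vec split: list.splits)
  have len2: "length xs = 2 \<longleftrightarrow> (\<exists>\<alpha> \<beta>. xs = [\<alpha>, \<beta>])" for xs :: "('b \<Rightarrow> 'a) list"
    by (auto simp: numeral_2_eq_2 length_Suc_conv)
  have lin: "?w (xs @ (\<alpha> + \<beta>) # ys) = ?w (xs @ \<alpha> # ys) + ?w (xs @ \<beta> # ys) \<and>
      ?w (xs @ fscale c \<alpha> # ys) = c * ?w (xs @ \<alpha> # ys)"
    if "xs \<in> lists (dual_space scale)" "ys \<in> lists (dual_space scale)"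
      "\<alpha> \<in> dual_space scale" "\<beta> \<in> dual_space scale" for xs ys \<alpha> \<beta> c
  proof (cases "length xs + length ys = 1")
    case False
    then show ?thesis by (simp add: zero)
  next
    case True
    then consider \<gamma> where "xs = []" "ys = [\<gamma>]" | \<gamma> where "xs = [\<gamma>]" "ys = []"
      by (auto simp: add_is_1 length_Suc_conv)
    then show ?thesis
      by cases (use that in \<open>auto simp: wedge_bidual_vec add_dual fscale_dual,
          auto simp: fscale_def algebra_simps\<close>)
  qed
  have alt: "?w xs = 0" if "\<not> distinct xs" for xs
    using that by (auto simp: wedge_bidual_vec split: list.splits)
  have out: "?w xs = 0" if "xs \<notin> lists (dual_space scale)" for xs
    using that by (auto simp: wedge_bidual_vec split: list.splits)
  show ?thesis
    unfolding alt_forms_def using lin alt out by blast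
qed

lemma multivectors_add: "\<xi> \<in> multivectors scale \<Longrightarrow> \<eta> \<in> multivectors scale \<Longrightarrow> \<xi> + \<eta> \<in> multivectors scale"
  by (auto simp: alt_forms_def algebra_simps)

lemma multivectors_zero: "0 \<in> multivectors scale"
  by (auto simp: alt_forms_def)

lemma bidual_vec_multivector: "bidual_vec scale v \<in> multivectors scale"
  unfolding alt_forms_def
  by (auto simp: degree_one_def append_eq_Cons_conv Cons_eq_append_conv add_dual fscale_dual split: list.splits)
    (auto simp: fscale_def)

lemma skew_mapD:
  "skew_map scale s \<Longrightarrow> \<alpha> \<in> dual_space scale \<Longrightarrow> \<beta> \<in> dual_space scale \<Longrightarrow> \<beta> (s \<alpha>) = - \<alpha> (s \<beta>)"
  by (auto simp: skew_map_def)

text \<open>Skewness moves \<open>s\<close> off the dual basis covector, which leaves the basis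
  expansion of a single vector. These sums arise from the two halves of a bivector
  contraction.\<close>

lemma skew_expand:
  assumes skew: "skew_map scale s"
    and "\<alpha> \<in> dual_space scale" "\<beta> \<in> dual_space scale"
  shows "(\<Sum>b\<in>Basis. \<alpha> b * \<beta> (s (coord b))) = \<beta> (s \<alpha>)"
    and "(\<Sum>b\<in>Basis. \<alpha> (s (coord b)) * \<beta> b) = - \<beta> (s \<alpha>)"
proof -
  have ex: "\<gamma> v = (\<Sum>b\<in>Basis. coord b v * \<gamma> b)" if "\<gamma> \<in> dual_space scale" for \<gamma> v
    using dual_sum[OF that, of "\<lambda>b. scale (coord b v) b" Basis] by (simp add: sum_coord dual_scale[OF that])
  have "(\<Sum>b\<in>Basis. \<alpha> b * \<beta> (s (coord b))) = - (\<Sum>b\<in>Basis. coord b (s \<beta>) * \<alpha> b)"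
    by (simp add: skew_mapD[OF skew coord_dual assms(3)] sum_negf mult.commute)
  also have "\<dots> = \<beta> (s \<alpha>)" using ex[OF assms(2), of "s \<beta>"] skew_mapD[OF skew assms(2,3)] by simp
  finally show "(\<Sum>b\<in>Basis. \<alpha> b * \<beta> (s (coord b))) = \<beta> (s \<alpha>)" .
  have "(\<Sum>b\<in>Basis. \<alpha> (s (coord b)) * \<beta> b) = - (\<Sum>b\<in>Basis. coord b (s \<alpha>) * \<beta> b)"
    by (simp add: skew_mapD[OF skew coord_dual assms(2)] sum_negf)
  then show "(\<Sum>b\<in>Basis. \<alpha> (s (coord b)) * \<beta> b) = - \<beta> (s \<alpha>)" using ex[OF assms(3), of "s \<alpha>"] by simp
qed

lemma bicontraction_fscale: "bicontraction u B (fscale c \<phi>) = fscale c (bicontraction u B \<phi>)"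
  for \<phi> :: "'b list \<Rightarrow> 'a"
  by (simp add: bicontraction_def int_prod_scale fscale_sum fscale_fscale mult.commute)

lemma bicontraction_forms: "\<phi> \<in> forms scale \<Longrightarrow> bicontraction u B \<phi> \<in> forms scale"
  unfolding bicontraction_def by (intro forms_fscale forms_sum forms_int_prod)

text \<open>A contraction passes two others, and the two signs cancel.\<close>

lemma bicontraction_int_prod:
  assumes "\<phi> \<in> forms scale"
  shows "bicontraction u B (int_prod v \<phi>) = int_prod v (bicontraction u B \<phi>)"
proof -
  have "int_prod b (int_prod c (int_prod v \<phi>)) = int_prod v (int_prod b (int_prod c \<phi>))" for b c
  proof -
    have "int_prod b (int_prod c (int_prod v \<phi>)) = fscale (- 1) (int_prod b (int_prod v (int_prod c \<phi>)))"
      by (simp only: int_prod_anticommute[OF assms, of c v] int_prod_scale)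
    also have "\<dots> = int_prod v (int_prod b (int_prod c \<phi>))"
      by (simp only: int_prod_anticommute[OF forms_int_prod[OF assms], of b v c] fscale_fscale)
        (simp add: fscale_def)
    finally show ?thesis .
  qed
  then show ?thesis by (simp add: bicontraction_def int_prod_scale int_prod_sum)
qed

lemma bicontraction_apply:
  "bicontraction u B \<phi> xs = (\<Sum>b\<in>B. \<phi> (u b # b # xs)) / 2" for \<phi> :: "'b list \<Rightarrow> 'a"
  by (simp add: bicontraction_def fscale_def sum_fun_apply int_prod_def)

text \<open>Moving \<alpha> past the two contractions leaves two correction sums. By
  \<open>skew_expand\<close> each equals - \<iota>(s \<alpha>)\<phi>, and the factor 1/2 turns the
  pair into one.\<close>

lemma bicontraction_covector_wedge:
  assumes two: "(2 :: 'a) \<noteq> 0"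
    and skew: "skew_map scale s"
    and \<alpha>: "\<alpha> \<in> dual_space scale" and \<phi>: "\<phi> \<in> forms scale"
  shows "bicontraction (\<lambda>b. s (coord b)) Basis (wedge (covector \<alpha>) \<phi>)
    = wedge (covector \<alpha>) (bicontraction (\<lambda>b. s (coord b)) Basis \<phi>) - int_prod (s \<alpha>) \<phi>"
proof
  fix xs
  let ?u = "\<lambda>b. s (coord b)"
  \<comment> \<open>This functional takes the place of \<beta> in
    \<open>skew_expand\<close>.\<close>
  have dual: "(\<lambda>v. \<phi> (v # xs)) \<in> dual_space scale"
    using forms_add_arg[OF \<phi>, of "[]"] forms_scale_arg[OF \<phi>, of "[]"] by (intro dualI) auto
  have w: "wedge (covector \<alpha>) \<phi> (u # b # xs)
      = \<alpha> u * \<phi> (b # xs) - \<alpha> b * \<phi> (u # xs) + wedge (covector \<alpha>) (int_prod b (int_prod u \<phi>)) xs" for u b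
    by (simp add: wedge_covector_Cons) (simp add: int_prod_def)
  have "wedge (covector \<alpha>) (bicontraction ?u Basis \<phi>) xs
      = (\<Sum>b\<in>Basis. wedge (covector \<alpha>) (int_prod b (int_prod (?u b) \<phi>)) xs) / 2"
    by (simp add: bicontraction_def wedge_scale_right wedge_sum_right) (simp add: fscale_def sum_fun_apply)
  then show "bicontraction ?u Basis (wedge (covector \<alpha>) \<phi>) xs
      = (wedge (covector \<alpha>) (bicontraction ?u Basis \<phi>) - int_prod (s \<alpha>) \<phi>) xs"
    using skew_expand[OF skew \<alpha> dual] two
    by (simp add: bicontraction_apply w sum.distrib sum_subtractf int_prod_def field_simps)
qed

text \<open>Since \<open>contraction\<close> is chosen by description, only its homomorphism
  properties are available. They suffice once \<pi> is written as half the sum of the products of b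
  with the image under \<open>s\<close> of its dual covector; this is checked on pairs of covectors
  by \<open>skew_expand\<close>.\<close>

lemma contraction_bivector:
  assumes two: "(2 :: 'a) \<noteq> 0"
    and \<pi>: "\<pi> \<in> multivectors scale" "\<And>xs. length xs \<noteq> 2 \<Longrightarrow> \<pi> xs = 0"
    and s: "\<And>\<alpha> \<beta>. \<alpha> \<in> dual_space scale \<Longrightarrow> \<beta> \<in> dual_space scale \<Longrightarrow> \<beta> (s \<alpha>) = \<pi> [\<alpha>, \<beta>]"
    and skew: "skew_map scale s"
    and \<phi>: "\<phi> \<in> forms scale"
  shows "contraction scale \<pi> \<phi> = bicontraction (\<lambda>b. s (coord b)) Basis \<phi>"
proof -
  let ?w = "\<lambda>b. wedge (bidual_vec scale b) (bidual_vec scale (s (coord b)))"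
  have sum_mv: "(\<Sum>b\<in>I. ?w b) \<in> multivectors scale" for I
    by (induction I rule: infinite_finite_induct)
      (simp_all add: multivectors_zero multivectors_add wedge_bidual_vec_multivector
        del: plus_fun_apply zero_fun_apply)
  have "\<pi> xs = fscale (1 / 2) (\<Sum>b\<in>Basis. ?w b) xs" for xs
  proof (cases "length xs = 2 \<and> xs \<in> lists (dual_space scale)")
    case True
    then obtain \<alpha> \<beta> where xs: "xs = [\<alpha>, \<beta>]" "\<alpha> \<in> dual_space scale" "\<beta> \<in> dual_space scale"
      by (auto simp: numeral_2_eq_2 length_Suc_conv)
    have "(\<Sum>b\<in>Basis. ?w b xs) = (\<Sum>b\<in>Basis. \<alpha> b * \<beta> (s (coord b))) - (\<Sum>b\<in>Basis. \<alpha> (s (coord b)) * \<beta> b)"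
      using xs by (simp add: wedge_bidual_vec sum_subtractf mult.commute)
    also have "\<dots> = 2 * \<pi> xs" using skew_expand[OF skew xs(2,3)] s[OF xs(2,3)] xs(1) by simp
    finally show ?thesis using two by (simp add: fscale_def sum_fun_apply)
  next
    case False
    then have "\<pi> xs = 0" using \<pi> by (auto simp: alt_forms_def)
    moreover have "?w b xs = 0" for b
      using False by (auto simp: wedge_bidual_vec split: list.splits)
    ultimately show ?thesis by (simp add: fscale_def sum_fun_apply)
  qed
  then have \<pi>_eq: "\<pi> = fscale (1 / 2) (\<Sum>b\<in>Basis. ?w b)" by blast
  let ?\<iota> = "contraction scale"
  note c = is_contraction_contraction[unfolded is_contraction_def]
  have add: "?\<iota> (\<xi> + \<eta>) \<phi> = ?\<iota> \<xi> \<phi> + ?\<iota> \<eta> \<phi>" if "\<xi> \<in> multivectors scale" "\<eta> \<in> multivectors scale" for \<xi> \<eta>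
    using c \<phi> that by blast
  have scl: "?\<iota> (fscale d \<xi>) \<phi> = fscale d (?\<iota> \<xi> \<phi>)" if "\<xi> \<in> multivectors scale" for \<xi> d
    using c \<phi> that by blast
  have zero: "?\<iota> 0 \<phi> = 0" using add[OF multivectors_zero multivectors_zero] by simp
  have "?\<iota> (\<Sum>b\<in>I. ?w b) \<phi> = (\<Sum>b\<in>I. ?\<iota> (?w b) \<phi>)" for I
    by (induction I rule: infinite_finite_induct)
      (simp_all add: zero add sum_mv wedge_bidual_vec_multivector del: plus_fun_apply zero_fun_apply)
  moreover have "?\<iota> (?w b) \<phi> = int_prod b (int_prod (s (coord b)) \<phi>)" for b
    using c \<phi> by (simp add: bidual_vec_multivector forms_int_prod)
  ultimately show ?thesis by (simp add: \<pi>_eq scl sum_mv bicontraction_def)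
qed

end

section \<open>The spinor of the graph of a bivector\<close>

context finite_dimensional_vector_space
begin

lemma bicontraction_funpow_forms: "\<phi> \<in> forms scale \<Longrightarrow> (bicontraction u B ^^ n) \<phi> \<in> forms scale"
  by (induction n) (simp_all add: bicontraction_forms)

lemma bicontraction_funpow_degree:
  fixes \<phi> :: "'b list \<Rightarrow> 'a"
  assumes "\<And>xs. length xs \<noteq> N \<Longrightarrow> \<phi> xs = 0" "length xs + 2 * n \<noteq> N"
  shows "(bicontraction u B ^^ n) \<phi> xs = 0"
  using assms(2)
proof (induction n arbitrary: xs)
  case (Suc n)
  then show ?case by (simp add: bicontraction_apply)
qed (simp add: assms(1))

text \<open>The commutator of \<open>A\<close> with multiplication by \<alpha> is - \<iota>(s
  \<alpha>), which itself commutes with \<open>A\<close>. Each further power thus adds one copy of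
  the same term, as in differentiating a power.\<close>

lemma bicontraction_funpow_covector_wedge:
  fixes s :: "('b \<Rightarrow> 'a) \<Rightarrow> 'b"
  defines "A \<equiv> bicontraction (\<lambda>b. s (coord b)) Basis"
  assumes two: "(2 :: 'a) \<noteq> 0" and skew: "skew_map scale s"
    and \<alpha>: "\<alpha> \<in> dual_space scale" and \<phi>: "\<phi> \<in> forms scale" "wedge (covector \<alpha>) \<phi> = 0"
  shows "wedge (covector \<alpha>) ((A ^^ Suc n) \<phi>) = fscale (of_nat (Suc n)) (int_prod (s \<alpha>) ((A ^^ n) \<phi>))"
proof -
  have An: "(A ^^ n) \<phi> \<in> forms scale" for n
    unfolding A_def by (rule bicontraction_funpow_forms[OF \<phi>(1)])
  have step: "wedge (covector \<alpha>) (A \<psi>) = A (wedge (covector \<alpha>) \<psi>) + int_prod (s \<alpha>) \<psi>"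
    if "\<psi> \<in> forms scale" for \<psi>
    using bicontraction_covector_wedge[OF two skew \<alpha> that] by (simp add: A_def)
  show ?thesis
  proof (induction n)
    case 0
    have "A 0 = 0" using bicontraction_fscale[of _ _ 0 0] by (simp add: A_def fscale_def zero_fun_def)
    then show ?case using step[OF \<phi>(1)] \<phi>(2) by (simp add: fscale_def)
  next
    case (Suc n)
    have "A (fscale c (int_prod v ((A ^^ n) \<phi>))) = fscale c (int_prod v (A ((A ^^ n) \<phi>)))" for c v
      unfolding A_def by (simp only: bicontraction_fscale bicontraction_int_prod[OF An[unfolded A_def]])
    then have "wedge (covector \<alpha>) ((A ^^ Suc (Suc n)) \<phi>)
        = fscale (of_nat (Suc n)) (int_prod (s \<alpha>) ((A ^^ Suc n) \<phi>)) + int_prod (s \<alpha>) ((A ^^ Suc n) \<phi>)"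
      using step[OF An, of "Suc n"] Suc.IH by simp
    then show ?case by (simp add: fun_eq_iff fscale_def algebra_simps)
  qed
qed

lemma forms_top_part:
  assumes "\<phi> \<in> forms scale"
  shows "top_part scale \<phi> \<in> forms scale"
  using assms by (intro formsI) (auto simp: top_part_def forms_add_arg forms_scale_arg forms_not_distinct)

text \<open>The product could only live in degree dim V + 1, where forms vanish. In lower degrees it
  sees components of \<open>top_part\<close> that are zero by definition.\<close>

lemma covector_wedge_top_part:
  assumes "\<alpha> \<in> dual_space scale" "\<phi> \<in> forms scale"
  shows "wedge (covector \<alpha>) (top_part scale \<phi>) = 0"
proof
  fix xs
  show "wedge (covector \<alpha>) (top_part scale \<phi>) xs = 0 xs"
  proof (cases "dim UNIV < length xs")
    case True
    then show ?thesis
      using forms_eq_0_above_dim forms_wedge[OF forms_covector forms_top_part] assms by simp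
  next
    case False
    then show ?thesis
    proof (cases "length xs")
      case (Suc m)
      then have "wedge (covector \<alpha>) (top_part scale \<phi>) xs = 0"
        by (intro wedge_covector_eq_0_at[of m]) (use False in \<open>auto simp: top_part_def\<close>)
      then show ?thesis by simp
    qed (simp add: degree_one_def)
  qed
qed

text \<open>Descending induction on degree. Annihilation expresses \<alpha> \<and> \<phi> in degree
  k + 1 through the component of \<phi> in degree k + 2, already known to vanish; then
  \<open>forms_eq_0_if_wedge_covector\<close> disposes of degree k. The top degree, which that lemma
  excludes, is covered by the assumption.\<close>

lemma annihilated_by_graph_eq_0:
  assumes \<phi>: "\<phi> \<in> forms scale" and top: "top_part scale \<phi> = 0"
    and ann: "\<And>\<alpha>. \<alpha> \<in> dual_space scale \<Longrightarrow> clifford_action (s \<alpha>, \<alpha>) \<phi> = 0"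
  shows "\<phi> = 0"
proof
  show "\<phi> xs = 0 xs" for xs
  proof (induction "dim UNIV - length xs" arbitrary: xs rule: less_induct)
    case less
    consider "dim UNIV < length xs" | "length xs = dim UNIV" | "length xs < dim UNIV" by linarith
    then show ?case
    proof cases
      case 1
      then show ?thesis using forms_eq_0_above_dim[OF \<phi>] by simp
    next
      case 2
      then show ?thesis using fun_cong[OF top, of xs] by (simp add: top_part_def)
    next
      case 3
      have "\<phi> xs = 0"
      proof (rule forms_eq_0_if_wedge_covector[OF \<phi> refl 3])
        fix \<alpha> and ys :: "'b list"
        assume \<alpha>: "\<alpha> \<in> dual_space scale" and ys: "length ys = Suc (length xs)"
        have "\<phi> (s \<alpha> # ys) = 0" using less[of "s \<alpha> # ys"] ys 3 by simp
        then show "wedge (covector \<alpha>) \<phi> ys = 0"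
          using fun_cong[OF ann[OF \<alpha>], of ys] by (simp add: clifford_action_def int_prod_def)
      qed
      then show ?thesis by simp
    qed
  qed
qed

end

text \<open>\<open>C\<close> stands for \<open>contraction scale \<pi>\<close>, whose values are
  known on forms only; its powers are therefore replaced by those of the explicit operator
  \<open>A\<close>, starting from a form.\<close>

lemma spinor_eq_op_exp:
  fixes scale :: "'k::real_normed_field \<Rightarrow> 'v::ab_group_add \<Rightarrow> 'v"
  assumes fd: "finite_dimensional_vector_space scale Basis"
    and skew: "skew_map scale s" and \<chi>: "\<chi> \<in> forms scale"
    and C: "\<And>\<phi>. \<phi> \<in> forms scale \<Longrightarrow>
      C \<phi> = bicontraction (\<lambda>b. s (\<lambda>v. module.representation scale Basis v b)) Basis \<phi>"
    and ann: "\<And>\<alpha>. \<alpha> \<in> dual_space scale \<Longrightarrow> clifford_action (s \<alpha>, \<alpha>) \<chi> = 0"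
  shows "\<chi> = op_exp (- C) (top_part scale \<chi>)"
proof -
  interpret finite_dimensional_vector_space scale Basis by (rule fd)
  define A :: "('v list \<Rightarrow> 'k) \<Rightarrow> 'v list \<Rightarrow> 'k"
    where "A = bicontraction (\<lambda>b. s (coord b)) Basis"
  define T where "T = top_part scale \<chi>"
  define N where "N = dim UNIV"
  define c :: "nat \<Rightarrow> 'k" where "c n = (- 1) ^ n / fact n" for n
  \<comment> \<open>\<open>A\<close> lowers the degree by 2, so every power with 2n > N vanishes on
    \<open>T\<close>. The summand n = N + 1 is zero and lets the index shift below end at N.\<close>
  define \<omega> where "\<omega> = (\<Sum>n<Suc (Suc N). fscale (c n) ((A ^^ n) T))"
  have T: "T \<in> forms scale" unfolding T_def by (rule forms_top_part[OF \<chi>])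
  have An: "(A ^^ n) T \<in> forms scale" for n
    unfolding A_def by (rule bicontraction_funpow_forms[OF T])
  have deg: "(A ^^ n) T xs = 0" if "length xs + 2 * n \<noteq> N" for n xs
    unfolding A_def
    by (rule bicontraction_funpow_degree[OF _ that]) (simp add: T_def top_part_def N_def)
  have pow: "((- C) ^^ n) T = fscale ((- 1) ^ n) ((A ^^ n) T)" for n
  proof (induction n)
    case (Suc n)
    have "((- C) ^^ Suc n) T = - C (fscale ((- 1) ^ n) ((A ^^ n) T))"
      by (simp add: Suc.IH)
    also have "\<dots> = - fscale ((- 1) ^ n) (A ((A ^^ n) T))"
      using C[OF forms_fscale[OF An]] by (simp add: A_def bicontraction_fscale)
    also have "\<dots> = fscale ((- 1) ^ Suc n) ((A ^^ Suc n) T)"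
      by (rule ext) (simp add: fscale_def)
    finally show ?case .
  qed (simp add: fscale_def)
  have \<omega>_exp: "op_exp (- C) T = \<omega>"
  proof
    fix xs
    have "(\<Sum>n. ((- C) ^^ n) T xs / fact n) = (\<Sum>n<Suc (Suc N). ((- C) ^^ n) T xs / fact n)"
      by (rule suminf_finite) (auto simp: pow fscale_def intro!: deg)
    then show "op_exp (- C) T xs = \<omega> xs"
      by (simp add: op_exp_def \<omega>_def sum_fun_apply pow fscale_def c_def del: sum.lessThan_Suc)
  qed
  have \<omega>_ann: "wedge (covector \<alpha>) \<omega> + int_prod (s \<alpha>) \<omega> = 0" if \<alpha>: "\<alpha> \<in> dual_space scale" for \<alpha>
  proof -
    \<comment> \<open>This recurrence absorbs the factor \<open>Suc n\<close> of the commutation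
      lemma, so that term n + 1 of \<alpha> \<and> \<omega> is opposite to term n of \<iota>(s
      \<alpha>)\<omega>.\<close>
    have cS: "c (Suc n) * of_nat (Suc n) = - c n" for n
      by (simp add: c_def field_simps del: of_nat_Suc)
    have T0: "wedge (covector \<alpha>) T = 0" unfolding T_def by (rule covector_wedge_top_part[OF \<alpha> \<chi>])
    have step: "fscale (c (Suc n)) (wedge (covector \<alpha>) ((A ^^ Suc n) T))
        = fscale (- c n) (int_prod (s \<alpha>) ((A ^^ n) T))" for n
      by (subst bicontraction_funpow_covector_wedge[OF _ skew \<alpha> T T0, folded A_def])
        (simp_all only: fscale_fscale cS, simp)
    have AN: "(A ^^ Suc N) T = 0" by (rule ext) (simp add: deg del: funpow.simps)
    have "wedge (covector \<alpha>) \<omega> = fscale (c 0) (wedge (covector \<alpha>) T)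
        + (\<Sum>n<Suc N. fscale (c (Suc n)) (wedge (covector \<alpha>) ((A ^^ Suc n) T)))"
      unfolding \<omega>_def wedge_sum_right wedge_scale_right by (subst sum.lessThan_Suc_shift) simp
    also have "\<dots> = (\<Sum>n<Suc N. fscale (- c n) (int_prod (s \<alpha>) ((A ^^ n) T)))"
      by (simp only: T0 step) (simp add: fscale_def zero_fun_def[symmetric] del: sum.lessThan_Suc)
    finally have "wedge (covector \<alpha>) \<omega> xs = - int_prod (s \<alpha>) \<omega> xs" for xs
      by (simp add: \<omega>_def int_prod_sum int_prod_scale AN del: sum.lessThan_Suc funpow.simps)
        (simp add: sum_fun_apply fscale_def sum_negf AN del: funpow.simps)
    then show ?thesis by (simp add: fun_eq_iff)
  qed
  define \<delta> where "\<delta> = \<chi> + fscale (- 1) \<omega>"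
  have "\<delta> = 0"
  proof (rule annihilated_by_graph_eq_0)
    show "\<delta> \<in> forms scale"
      unfolding \<delta>_def \<omega>_def by (intro forms_add forms_fscale forms_sum \<chi> An)
    \<comment> \<open>In degree N only the summand n = 0, which is \<open>T\<close>,
      survives.\<close>
    have "\<omega> xs = \<chi> xs" if "length xs = N" for xs
    proof -
      have "\<omega> xs = c 0 * T xs + (\<Sum>n<Suc N. c (Suc n) * (A ^^ Suc n) T xs)"
        unfolding \<omega>_def sum_fun_apply fscale_def by (subst sum.lessThan_Suc_shift) simp
      also have "(\<Sum>n<Suc N. c (Suc n) * (A ^^ Suc n) T xs) = 0"
        by (rule sum.neutral) (simp add: deg that del: funpow.simps)
      finally show ?thesis using that by (simp add: c_def T_def top_part_def N_def)
    qed
    then show "top_part scale \<delta> = 0"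
      by (auto simp: fun_eq_iff top_part_def \<delta>_def fscale_def N_def)
    show "clifford_action (s \<alpha>, \<alpha>) \<delta> = 0" if "\<alpha> \<in> dual_space scale" for \<alpha>
    proof -
      have "clifford_action (s \<alpha>, \<alpha>) \<delta>
          = clifford_action (s \<alpha>, \<alpha>) \<chi> + fscale (- 1) (wedge (covector \<alpha>) \<omega> + int_prod (s \<alpha>) \<omega>)"
        by (simp add: clifford_action_def \<delta>_def wedge_add_right wedge_scale_right int_prod_add
            int_prod_scale fscale_add add_ac del: plus_fun_apply)
      then show ?thesis using ann[OF that] \<omega>_ann[OF that] by (simp add: fscale_def zero_fun_def)
    qed
  qed
  then have "\<chi> = \<omega>" by (simp add: \<delta>_def fun_eq_iff fscale_def)
  then show ?thesis using \<omega>_exp by (simp add: T_def)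
qed

section \<open>The graph of the bivector of a splitting\<close>

text \<open>Well-definedness: isotropy forces the value to be - \<alpha>'(v) for every lift of v, so
  the description has a unique solution.\<close>

lemma two_form_eq:
  fixes G :: "('v \<times> ('v \<Rightarrow> 'k::ab_group_add)) set"
  assumes iso: "\<And>w w'. w \<in> G \<Longrightarrow> w' \<in> G \<Longrightarrow> pairing w w' = 0"
    and G: "(v, \<alpha>) \<in> G" "(v', \<alpha>') \<in> G"
  shows "two_form G v v' = \<alpha> v'"
  unfolding two_form_def
proof (rule the_equality)
  fix c assume "\<exists>\<beta> \<beta>'. (v, \<beta>) \<in> G \<and> (v', \<beta>') \<in> G \<and> c = \<beta> v'"
  then obtain \<beta> where "(v, \<beta>) \<in> G" "c = \<beta> v'" by blast
  then have "c + \<alpha>' v = 0" using iso[OF _ G(2), of "(v, \<beta>)"] by (simp add: pairing_def)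
  moreover have "\<alpha> v' + \<alpha>' v = 0" using iso[OF G] by (simp add: pairing_def)
  ultimately show "c = \<alpha> v'" by (metis add_right_cancel)
qed (use G in blast)

section \<open>The graph, its 2-form and its skewness\<close>

context finite_dimensional_vector_space
begin

lemma lagrangian_isotropic: "lagrangian scale E \<Longrightarrow> w \<in> E \<Longrightarrow> w' \<in> E \<Longrightarrow> pairing w w' = 0"
  unfolding lagrangian_def perp_def by blast

lemma lagrangian_uminus:
  assumes "lagrangian scale E" "w \<in> E"
  shows "- w \<in> E"
proof -
  interpret d: module "double_scale scale" by (rule module_double)
  show ?thesis using assms d.subspace_neg by (simp add: lagrangian_def)
qed

lemma bivector_graph_splitting:
  assumes EF: "lagrangian_splitting scale E F"
  shows "bivector_graph scale (splitting_bivector scale E F) = top_wedge E F"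
proof (intro set_eqI iffI)
  have lag: "lagrangian scale E" "lagrangian scale F" using EF by (auto simp: lagrangian_splitting_def)
  fix w
  show "w \<in> top_wedge E F" if "w \<in> bivector_graph scale (splitting_bivector scale E F)"
  proof -
    from that obtain \<alpha> where \<alpha>: "\<alpha> \<in> dual_space scale"
      and w: "w = (- fst (proj_along E F (0, \<alpha>)), \<alpha>)"
      by (auto simp: bivector_graph_def sharp_splitting_bivector)
    define e where "e = proj_along E F (0, \<alpha>)"
    have "(0, \<alpha>) \<in> double_space scale" using \<alpha> by (simp add: double_space_def)
    note p = proj_along_splitting[OF EF this, folded e_def]
    have "(- fst e, - snd e) \<in> E" using lagrangian_uminus[OF lag(1) p(1)] by (simp add: uminus_prod_def)
    moreover have "(- fst e, \<alpha> - snd e) \<in> F" using p(2) by (simp add: minus_prod_def)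
    ultimately show ?thesis
      unfolding w top_wedge_def e_def[symmetric] by force
  qed
  show "w \<in> bivector_graph scale (splitting_bivector scale E F)" if "w \<in> top_wedge E F"
  proof -
    from that obtain v \<alpha>\<^sub>1 \<alpha>\<^sub>2 where w: "w = (v, \<alpha>\<^sub>2 - \<alpha>\<^sub>1)" and E: "(v, \<alpha>\<^sub>1) \<in> E" and F: "(v, \<alpha>\<^sub>2) \<in> F"
      by (auto simp: top_wedge_def)
    have "\<alpha>\<^sub>1 \<in> dual_space scale" "\<alpha>\<^sub>2 \<in> dual_space scale"
      using E F lag by (auto simp: lagrangian_def double_space_def)
    then have dual: "\<alpha>\<^sub>2 - \<alpha>\<^sub>1 \<in> dual_space scale"
      by (intro dualI) (simp_all add: dual_add dual_scale algebra_simps)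
    \<comment> \<open>The argument is \<open>(0, \<alpha>\<^sub>2 - \<alpha>\<^sub>1)\<close>,
      already split into its parts in \<open>E\<close> and \<open>F\<close>; uniqueness of the
      splitting identifies the projection.\<close>
    have "proj_along E F (- (v, \<alpha>\<^sub>1) + (v, \<alpha>\<^sub>2)) = - (v, \<alpha>\<^sub>1)"
      by (rule proj_along_add[OF EF lagrangian_uminus[OF lag(1) E] F])
    then have "sharp scale (splitting_bivector scale E F) (\<alpha>\<^sub>2 - \<alpha>\<^sub>1) = v"
      by (simp add: sharp_splitting_bivector[OF dual])
    then show ?thesis using dual by (auto simp: w bivector_graph_def image_iff)
  qed
qed

text \<open>Over fixed base vectors the pairing is additive in the covector parts, so here it is the
  pairing in \<open>F\<close> minus the pairing in \<open>E\<close>, and both vanish.\<close>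

lemma top_wedge_isotropic:
  assumes "lagrangian scale E" "lagrangian scale F" "w \<in> top_wedge E F" "w' \<in> top_wedge E F"
  shows "pairing w w' = 0"
proof -
  obtain v \<alpha>\<^sub>1 \<alpha>\<^sub>2 where w: "w = (v, \<alpha>\<^sub>2 - \<alpha>\<^sub>1)" "(v, \<alpha>\<^sub>1) \<in> E" "(v, \<alpha>\<^sub>2) \<in> F"
    using assms(3) by (auto simp: top_wedge_def)
  obtain v' \<beta>\<^sub>1 \<beta>\<^sub>2 where w': "w' = (v', \<beta>\<^sub>2 - \<beta>\<^sub>1)" "(v', \<beta>\<^sub>1) \<in> E" "(v', \<beta>\<^sub>2) \<in> F"
    using assms(4) by (auto simp: top_wedge_def)
  have "pairing w w' = pairing (v, \<alpha>\<^sub>2) (v', \<beta>\<^sub>2) - pairing (v, \<alpha>\<^sub>1) (v', \<beta>\<^sub>1)"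
    using w w' by (simp add: pairing_def)
  also have "\<dots> = 0" using lagrangian_isotropic assms(1,2) w w' by simp
  finally show ?thesis .
qed

lemma two_form_top_wedge:
  assumes lag: "lagrangian scale E" "lagrangian scale F"
    and v: "v \<in> fst ` top_wedge E F" "v' \<in> fst ` top_wedge E F"
  shows "two_form (top_wedge E F) v v' = two_form F v v' - two_form E v v'"
proof -
  obtain \<alpha>\<^sub>1 \<alpha>\<^sub>2 where w: "(v, \<alpha>\<^sub>1) \<in> E" "(v, \<alpha>\<^sub>2) \<in> F"
    using v(1) by (auto simp: top_wedge_def)
  obtain \<beta>\<^sub>1 \<beta>\<^sub>2 where w': "(v', \<beta>\<^sub>1) \<in> E" "(v', \<beta>\<^sub>2) \<in> F"
    using v(2) by (auto simp: top_wedge_def)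
  have G: "(v, \<alpha>\<^sub>2 - \<alpha>\<^sub>1) \<in> top_wedge E F" "(v', \<beta>\<^sub>2 - \<beta>\<^sub>1) \<in> top_wedge E F"
    using w w' by (auto simp: top_wedge_def)
  show ?thesis
    using two_form_eq[OF top_wedge_isotropic[OF lag] G] two_form_eq[OF lagrangian_isotropic[OF lag(1)] w(1) w'(1)]
      two_form_eq[OF lagrangian_isotropic[OF lag(2)] w(2) w'(2)]
    by simp
qed

text \<open>Skewness of the sharp map is isotropy of its graph: the pairing of two graph points is
  \<alpha>(s \<beta>) + \<beta>(s \<alpha>).\<close>

lemma skew_map_sharp:
  assumes EF: "lagrangian_splitting scale E F"
  shows "skew_map scale (sharp scale (splitting_bivector scale E F))"
proof -
  let ?s = "sharp scale (splitting_bivector scale E F)"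
  have lag: "lagrangian scale E" "lagrangian scale F" using EF by (auto simp: lagrangian_splitting_def)
  have "(?s \<alpha>, \<alpha>) \<in> top_wedge E F" if "\<alpha> \<in> dual_space scale" for \<alpha>
    using that unfolding bivector_graph_splitting[OF EF, symmetric] bivector_graph_def by blast
  then have "pairing (?s \<alpha>, \<alpha>) (?s \<beta>, \<beta>) = 0"
    if "\<alpha> \<in> dual_space scale" "\<beta> \<in> dual_space scale" for \<alpha> \<beta>
    using top_wedge_isotropic[OF lag] that by blast
  then show ?thesis by (simp add: skew_map_def pairing_def eq_neg_iff_add_eq_0 add.commute)
qed

end

theorem proposition1p17:
  fixes scale :: "'k::real_normed_field \<Rightarrow> 'v::ab_group_add \<Rightarrow> 'v"
    and Basis :: "'v set"
    and E F :: "('v \<times> ('v \<Rightarrow> 'k)) set"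
    and \<pi> :: "('v \<Rightarrow> 'k) list \<Rightarrow> 'k"
  assumes "finite_dimensional_vector_space scale Basis"
    and "lagrangian_splitting scale E F"
    and "\<pi> = splitting_bivector scale E F"
  shows "bivector_graph scale \<pi> = top_wedge E F \<and>
         sharp scale \<pi> ` dual_space scale = range_V E \<inter> range_V F \<and>
         (\<forall>v \<in> sharp scale \<pi> ` dual_space scale. \<forall>v' \<in> sharp scale \<pi> ` dual_space scale.
            two_form (bivector_graph scale \<pi>) v v' = two_form F v v' - two_form E v v') \<and>
         (\<forall>\<phi> \<psi>. pure_spinor_defining scale \<phi> E \<and> pure_spinor_defining scale \<psi> F \<longrightarrow>
            wedge (form_transpose scale \<phi>) \<psi> =
              op_exp (- contraction scale \<pi>) (top_part scale (wedge (form_transpose scale \<phi>) \<psi>)))"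
proof -
  interpret finite_dimensional_vector_space scale Basis by (rule assms(1))
  note EF = assms(2)
  have lag: "lagrangian scale E" "lagrangian scale F" using EF by (auto simp: lagrangian_splitting_def)
  let ?s = "sharp scale \<pi>"
  have graph: "bivector_graph scale \<pi> = top_wedge E F"
    unfolding assms(3) by (rule bivector_graph_splitting[OF EF])
  have ran: "?s ` dual_space scale = fst ` top_wedge E F"
    unfolding graph[symmetric] by (simp add: bivector_graph_def image_image)
  have "fst ` top_wedge E F = range_V E \<inter> range_V F"
    by (force simp: top_wedge_def range_V_def)
  moreover have "wedge (form_transpose scale \<phi>) \<psi> =
      op_exp (- contraction scale \<pi>) (top_part scale (wedge (form_transpose scale \<phi>) \<psi>))"
    if \<phi>: "pure_spinor_defining scale \<phi> E" and \<psi>: "pure_spinor_defining scale \<psi> F" for \<phi> \<psi>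
  proof (rule spinor_eq_op_exp[OF assms(1)])
    have forms: "\<phi> \<in> forms scale" "\<psi> \<in> forms scale"
      using \<phi> \<psi> by (auto simp: pure_spinor_defining_def)
    show skew: "skew_map scale ?s" unfolding assms(3) by (rule skew_map_sharp[OF EF])
    have "form_transpose scale \<phi> \<in> forms scale"
      using is_transpose_form_transpose forms(1) by (simp add: is_transpose_def linear_endo_def)
    then show "wedge (form_transpose scale \<phi>) \<psi> \<in> forms scale" using forms by (simp add: forms_wedge)
    show "contraction scale \<pi> \<theta> = bicontraction (\<lambda>b. ?s (coord b)) Basis \<theta>" if "\<theta> \<in> forms scale" for \<theta>
    proof (rule contraction_bivector[OF _ _ _ _ skew that])
      show "\<pi> \<in> multivectors scale"
        using splitting_bivector_multivector(1)[OF EF] by (simp add: assms(3))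
      show "\<pi> xs = 0" if "length xs \<noteq> 2" for xs
        using splitting_bivector_multivector(2)[OF EF _ that] by (simp add: assms(3))
      show "\<beta> (?s \<alpha>) = \<pi> [\<alpha>, \<beta>]" if "\<alpha> \<in> dual_space scale" "\<beta> \<in> dual_space scale" for \<alpha> \<beta>
        using that unfolding assms(3) by (simp add: sharp_splitting_bivector splitting_bivector_def)
    \<comment> \<open>What remains is that 2 is nonzero in the scalar field.\<close>
    qed simp
    show "clifford_action (?s \<alpha>, \<alpha>) (wedge (form_transpose scale \<phi>) \<psi>) = 0"
      if "\<alpha> \<in> dual_space scale" for \<alpha>
    proof -
      \<comment> \<open>The graph point is a difference of lifts of one vector to \<open>E\<close>
        and to \<open>F\<close>; these lifts annihilate \<phi> and \<psi> respectively.\<close>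
      have "(?s \<alpha>, \<alpha>) \<in> top_wedge E F"
        using that unfolding graph[symmetric] bivector_graph_def by blast
      then obtain \<alpha>\<^sub>1 \<alpha>\<^sub>2 where "\<alpha> = \<alpha>\<^sub>2 - \<alpha>\<^sub>1" and E: "(?s \<alpha>, \<alpha>\<^sub>1) \<in> E" and F: "(?s \<alpha>, \<alpha>\<^sub>2) \<in> F"
        by (auto simp: top_wedge_def)
      moreover have "\<alpha>\<^sub>1 \<in> dual_space scale"
        using E lag(1) by (auto simp: lagrangian_def double_space_def)
      moreover have "clifford_action (?s \<alpha>, \<alpha>\<^sub>1) \<phi> = 0" "clifford_action (?s \<alpha>, \<alpha>\<^sub>2) \<psi> = 0"
        using E F \<phi> \<psi> unfolding pure_spinor_defining_def by blast+
      ultimately show ?thesis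
        using clifford_action_transpose_wedge[OF forms(1)] by metis
    qed
  qed
  ultimately show ?thesis
    unfolding graph ran using two_form_top_wedge[OF lag] by blast
qed

end
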